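(* Consider a pointon with timelike worldline $\beta\subset\tilde M$ whose spin is prepared at $p=\beta(0)$ and measured at $q=\beta(\epsilon)$, $\epsilon>0$, so that the internal tangent spaces $M_p$ and $M_q$ are $1$-dimensional and $\dim M_{\beta(t)}>1$ for $t\in(0,\epsilon)$. Let $s$ be the ontic spin vector that exits $M_p$ and is parallel transported along $\beta$ to $q$. Then the spacetime model of spin reproduces the Born rule for spin wavefunction collapse: the probability $p(h_q(s)\,|\,h_p(s))$ that the measurement at $q$ has outcome $\hat h_q(\boldsymbol s)$, given the prepared $\hat h_p(\boldsymbol s)$, is $$p(h_q(s)\,|\,h_p(s))=\left|\langle\hat h_q(\boldsymbol s)\,|\,\hat h_p(\boldsymbol s)\rangle\right|^2 .$$ Explicitly: for every unit vector $\boldsymbol\psi\in S^2$ spanning $M_p$ and every unit vector $\boldsymbol\phi\in S^2$ spanning $M_q$, the probability that $\hat h_q(\boldsymbol s)=\boldsymbol\phi$ given that $\hat h_p(\boldsymbol s)=\boldsymbol\psi$ equals $|\langle\boldsymbol\phi|\boldsymbol\psi\rangle|^2$.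
   Context: Geometry. $(\tilde M,g)$ is an orientable Lorentzian $4$-manifold of signature $(+,-,-,-)$, and $\beta$ is a curve in $\tilde M$ with timelike unit tangent vector $v$. At each point $x=\beta(t)$ there is a linear map $h_x:\tilde M_x\to\tilde M_x$ on the tangent space $\tilde M_x=T_x\tilde M$ (the internal metric), which is a $g$-orthogonal projection (idempotent, $g$-symmetric) with $h_x(v)=0$. The internal tangent space at $x$ is $M_x:=\operatorname{im}h_x\subseteq\tilde M_x$. Let $e_0,\dots,e_3$ be an orthonormal tetrad parallel transported along $\beta$ with $e_0=v$. Vectors in $\operatorname{span}\{e_1,e_2,e_3\}$ are written as $3$-vectors (bold) via their components in $e_1,e_2,e_3$, with $\boldsymbol w\cdot\boldsymbol w'=-w^aw'_a$ the Euclidean dot product; using the parallel tetrad, the unit spheres in these spaces along $\beta$ are all identified with $S^2\subset\mathbb R^3$. The lines $M_p,M_q$ lie in $\operatorname{span}\{e_1,e_2,e_3\}$ and so are regarded as lines in $\mathbb R^3$. For $w\in\tilde M_x$ put $\hat h_x(w):=h_x(w)/|h_x(w)|$ if $|h_x(w)|\neq0$ and $\hat h_x(w):=0$ otherwise, where $|w|=\sqrt{|g(w,w)|}$. Thus if $\boldsymbol n\in S^2$ spans $M_x$ and $\boldsymbol s\in S^2$, then $\hat h_x(\boldsymbol s)=\boldsymbol n$, $-\boldsymbol n$ or $0$ according as $\boldsymbol s\cdot\boldsymbol n$ is positive, negative or zero. Rules of the model. (a) When a unit vector $s$ enters the $1$-dimensional space $M_q$ it is projected to $\hat h_q(s)$,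 which is the measurement outcome. (b) After the preparation at $p$ gives the unit vector $\hat h_p(\boldsymbol s)=\boldsymbol\psi$, the subsequent (ontic) spin vector $\boldsymbol s\in S^2$ is chosen at random among the unit vectors with $\hat h_p(\boldsymbol s)=\boldsymbol\psi$ (that is, with $\boldsymbol\psi\cdot\boldsymbol s>0$), with probability density $\tfrac1\pi\,\boldsymbol\psi\cdot\boldsymbol s$ with respect to the standard area measure on $S^2$. The vector $s$ is parallel transported from $p$ to $q$. Kets. Let $\mathcal H=\mathbb C|{\uparrow}\rangle\oplus\mathbb C|{\downarrow}\rangle$ with orthonormal basis $|{\uparrow}\rangle,|{\downarrow}\rangle$. For $\boldsymbol w=(\sin\theta\cos\varphi,\sin\theta\sin\varphi,\cos\theta)\in S^2$ with $0\le\theta\le\pi$, $0\le\varphi<2\pi$, set $|\boldsymbol w\rangle=\cos(\theta/2)|{\uparrow}\rangle+e^{i\varphi}\sin(\theta/2)|{\downarrow}\rangle$. *)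

theory Defs
  imports "HOL-Analysis.Analysis" "HOL-Library.Function_Algebras"
begin

section \<open>Smooth 4-manifolds\<close>

text \<open>Here and below, smoothness is only used on open sets.\<close>

primrec Ck_on :: "nat \<Rightarrow> ('a::real_normed_vector \<Rightarrow> 'b::real_normed_vector) \<Rightarrow> 'a set \<Rightarrow> bool" where
  "Ck_on 0 f S \<longleftrightarrow> continuous_on S f"
| "Ck_on (Suc k) f S \<longleftrightarrow>
     (\<forall>x\<in>S. f differentiable (at x)) \<and> (\<forall>v. Ck_on k (\<lambda>x. frechet_derivative f (at x) v) S)"

definition smooth_on :: "('a::real_normed_vector \<Rightarrow> 'b::real_normed_vector) \<Rightarrow> 'a set \<Rightarrow> bool" where
  "smooth_on f S \<longleftrightarrow> (\<forall>k. Ck_on k f S)"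

text \<open>A chart is a pair of its domain and its coordinate map. The manifold is the whole type
  \<open>'m\<close>, which will carry a Hausdorff second countable topology.\<close>

type_synonym 'm chart = "'m set \<times> ('m \<Rightarrow> real^4)"

definition chart_inv :: "'m chart \<Rightarrow> real^4 \<Rightarrow> 'm" where
  "chart_inv c = inv_into (fst c) (snd c)"

definition transition :: "'m chart \<Rightarrow> 'm chart \<Rightarrow> real^4 \<Rightarrow> real^4" where
  "transition c c' = snd c' \<circ> chart_inv c"

definition smooth_atlas :: "('m::topological_space) chart set \<Rightarrow> bool" where
  "smooth_atlas A \<longleftrightarrow>
     (\<forall>c\<in>A. open (fst c) \<and> open (snd c ` fst c) \<and>
             homeomorphism (fst c) (snd c ` fst c) (snd c) (chart_inv c)) \<and>
     (\<Union>c\<in>A. fst c) = UNIV \<and>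
     (\<forall>c\<in>A. \<forall>c'\<in>A. smooth_on (transition c c') (snd c ` (fst c \<inter> fst c')))"

definition charts_at :: "'m chart set \<Rightarrow> 'm \<Rightarrow> 'm chart set" where
  "charts_at A x = {c\<in>A. x \<in> fst c}"

text \<open>The differential at \<open>x\<close> of the change of coordinates from \<open>c\<close> to \<open>c'\<close>.\<close>

definition dtransition :: "'m chart \<Rightarrow> 'm chart \<Rightarrow> 'm \<Rightarrow> real^4 \<Rightarrow> real^4" where
  "dtransition c c' x = frechet_derivative (transition c c') (at (snd c x))"

definition orientable :: "('m::topological_space) chart set \<Rightarrow> bool" where
  "orientable A \<longleftrightarrow>
     (\<exists>B. smooth_atlas (A \<union> B) \<and> (\<Union>c\<in>B. fst c) = UNIV \<and>
          (\<forall>c\<in>B. \<forall>c'\<in>B. \<forall>x \<in> fst c \<inter> fst c'. 0 < det (matrix (dtransition c c' x))))"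


section \<open>Tangent vectors and Lorentzian metrics\<close>

text \<open>A tangent vector at \<open>x\<close> is the family of its coordinate vectors in the charts around \<open>x\<close>,
  related to each other by the contravariant transformation law; by convention it is \<open>0\<close> at all
  other charts. Such families form a subspace of a function space, which carries the pointwise
  vector space structure, so that \<open>span\<close> and \<open>dim\<close> of the library apply.\<close>

instantiation "fun" :: (type, real_vector) real_vector
begin

definition scaleR_fun :: "real \<Rightarrow> ('a \<Rightarrow> 'b) \<Rightarrow> 'a \<Rightarrow> 'b" where
  "scaleR_fun r f = (\<lambda>x. r *\<^sub>R f x)"

instance
  by standard (simp_all add: scaleR_fun_def plus_fun_def scaleR_add_right scaleR_add_left)

end

type_synonym 'm tvec = "'m chart \<Rightarrow> real^4"

definition tangent_space :: "'m chart set \<Rightarrow> 'm \<Rightarrow> 'm tvec set" where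
  "tangent_space A x =
     {w. (\<forall>c\<in>charts_at A x. \<forall>c'\<in>charts_at A x. w c' = dtransition c c' x (w c)) \<and>
         (\<forall>c. c \<notin> charts_at A x \<longrightarrow> w c = 0)}"

definition coord_vec :: "'m chart set \<Rightarrow> 'm chart \<Rightarrow> 'm \<Rightarrow> 4 \<Rightarrow> 'm tvec" where
  "coord_vec A c x i =
     (\<lambda>c'. if c' \<in> charts_at A x then dtransition c c' x (axis i 1) else 0)"

type_synonym 'm metric_field = "'m \<Rightarrow> 'm tvec \<Rightarrow> 'm tvec \<Rightarrow> real"

definition metric_matrix ::
  "'m chart set \<Rightarrow> 'm metric_field \<Rightarrow> 'm chart \<Rightarrow> real^4 \<Rightarrow> real^4^4" where
  "metric_matrix A g c y =
     (\<chi> i j. g (chart_inv c y) (coord_vec A c (chart_inv c y) i) (coord_vec A c (chart_inv c y) j))"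

definition minkowski :: "4 \<Rightarrow> 4 \<Rightarrow> real" where
  "minkowski i j = (if i \<noteq> j then 0 else if i = 0 then 1 else -1)"

definition orthonormal_frame ::
  "'m chart set \<Rightarrow> 'm metric_field \<Rightarrow> 'm \<Rightarrow> (4 \<Rightarrow> 'm tvec) \<Rightarrow> bool" where
  "orthonormal_frame A g x b \<longleftrightarrow>
     span (range b) = tangent_space A x \<and> (\<forall>i j. g x (b i) (b j) = minkowski i j)"

definition linear_on_tangent :: "'m chart set \<Rightarrow> 'm \<Rightarrow> ('m tvec \<Rightarrow> 'b::real_vector) \<Rightarrow> bool" where
  "linear_on_tangent A x f \<longleftrightarrow>
     (\<forall>u\<in>tangent_space A x. \<forall>w\<in>tangent_space A x. f (u + w) = f u + f w) \<and>
     (\<forall>a. \<forall>w\<in>tangent_space A x. f (a *\<^sub>R w) = a *\<^sub>R f w)"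

definition lorentzian_manifold ::
  "('m::{t2_space,second_countable_topology}) chart set \<Rightarrow> 'm metric_field \<Rightarrow> bool" where
  "lorentzian_manifold A g \<longleftrightarrow>
     smooth_atlas A \<and>
     (\<forall>x. \<forall>u\<in>tangent_space A x. linear_on_tangent A x (g x u)) \<and>
     (\<forall>x. \<forall>u\<in>tangent_space A x. \<forall>w\<in>tangent_space A x. g x u w = g x w u) \<and>
     (\<forall>x. \<exists>b. orthonormal_frame A g x b) \<and>
     (\<forall>c\<in>A. smooth_on (metric_matrix A g c) (snd c ` fst c))"


section \<open>Curves and parallel transport\<close>

definition differentiable_curve ::
  "('m::topological_space) chart set \<Rightarrow> real set \<Rightarrow> (real \<Rightarrow> 'm) \<Rightarrow> bool" where
  "differentiable_curve A I \<beta> \<longleftrightarrow>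
     continuous_on I \<beta> \<and>
     (\<forall>t\<in>I. \<forall>c\<in>charts_at A (\<beta> t). (\<lambda>\<tau>. snd c (\<beta> \<tau>)) differentiable (at t within I))"

definition velocity :: "'m chart set \<Rightarrow> real set \<Rightarrow> (real \<Rightarrow> 'm) \<Rightarrow> real \<Rightarrow> 'm tvec" where
  "velocity A I \<beta> t =
     (\<lambda>c. if c \<in> charts_at A (\<beta> t) then vector_derivative (\<lambda>\<tau>. snd c (\<beta> \<tau>)) (at t within I) else 0)"

definition metric_partial ::
  "'m chart set \<Rightarrow> 'm metric_field \<Rightarrow> 'm chart \<Rightarrow> real^4 \<Rightarrow> 4 \<Rightarrow> 4 \<Rightarrow> 4 \<Rightarrow> real" where
  "metric_partial A g c y l i j = frechet_derivative (metric_matrix A g c) (at y) (axis l 1) $ i $ j"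

text \<open>Christoffel symbols of the Levi-Civita connection; the first index is the upper one.\<close>

definition christoffel ::
  "'m chart set \<Rightarrow> 'm metric_field \<Rightarrow> 'm chart \<Rightarrow> real^4 \<Rightarrow> 4 \<Rightarrow> 4 \<Rightarrow> 4 \<Rightarrow> real" where
  "christoffel A g c y i j k =
     (\<Sum>l\<in>UNIV. matrix_inv (metric_matrix A g c y) $ i $ l *
        (metric_partial A g c y j l k + metric_partial A g c y k l j - metric_partial A g c y l j k)) / 2"

definition parallel_along ::
  "'m chart set \<Rightarrow> 'm metric_field \<Rightarrow> real set \<Rightarrow> (real \<Rightarrow> 'm) \<Rightarrow> (real \<Rightarrow> 'm tvec) \<Rightarrow> bool" where
  "parallel_along A g I \<beta> X \<longleftrightarrow>
     (\<forall>t\<in>I. X t \<in> tangent_space A (\<beta> t) \<and>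
        (\<forall>c\<in>charts_at A (\<beta> t).
           ((\<lambda>\<tau>. X \<tau> c) has_vector_derivative
              (\<chi> i. - (\<Sum>j\<in>UNIV. \<Sum>k\<in>UNIV. christoffel A g c (snd c (\<beta> t)) i j k *
                          velocity A I \<beta> t c $ j * X t c $ k)))
           (at t within I)))"

definition parallel_transport ::
  "'m chart set \<Rightarrow> 'm metric_field \<Rightarrow> (real \<Rightarrow> 'm) \<Rightarrow> real \<Rightarrow> real \<Rightarrow> 'm tvec \<Rightarrow> 'm tvec" where
  "parallel_transport A g \<beta> a b u =
     (THE w. \<exists>X. parallel_along A g {a..b} \<beta> X \<and> X a = u \<and> X b = w)"


section \<open>The internal metric\<close>

definition internal_metric_at ::
  "'m chart set \<Rightarrow> 'm metric_field \<Rightarrow> 'm \<Rightarrow> 'm tvec \<Rightarrow> ('m tvec \<Rightarrow> 'm tvec) \<Rightarrow> bool" where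
  "internal_metric_at A g x v hx \<longleftrightarrow>
     linear_on_tangent A x hx \<and>
     hx ` tangent_space A x \<subseteq> tangent_space A x \<and>
     (\<forall>w\<in>tangent_space A x. hx (hx w) = hx w) \<and>
     (\<forall>u\<in>tangent_space A x. \<forall>w\<in>tangent_space A x. g x (hx u) w = g x u (hx w)) \<and>
     hx v = 0"

definition internal_space :: "'m chart set \<Rightarrow> ('m \<Rightarrow> 'm tvec \<Rightarrow> 'm tvec) \<Rightarrow> 'm \<Rightarrow> 'm tvec set" where
  "internal_space A h x = h x ` tangent_space A x"

definition lorentz_norm :: "'m metric_field \<Rightarrow> 'm \<Rightarrow> 'm tvec \<Rightarrow> real" where
  "lorentz_norm g x w = sqrt \<bar>g x w w\<bar>"

definition h_hat ::
  "'m metric_field \<Rightarrow> ('m \<Rightarrow> 'm tvec \<Rightarrow> 'm tvec) \<Rightarrow> 'm \<Rightarrow> 'm tvec \<Rightarrow> 'm tvec" where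
  "h_hat g h x w =
     (if lorentz_norm g x (h x w) \<noteq> 0 then (1 / lorentz_norm g x (h x w)) *\<^sub>R h x w else 0)"

text \<open>The vector of \<open>span {e\<^sub>1, e\<^sub>2, e\<^sub>3}\<close> at \<open>\<beta> t\<close> with components \<open>w\<close>. The numerals below \<open>e\<close>
  belong to the index type \<open>4\<close>, whose elements are \<open>0, 1, 2, 3\<close>.\<close>

definition spatial :: "(4 \<Rightarrow> real \<Rightarrow> 'm tvec) \<Rightarrow> real \<Rightarrow> real^3 \<Rightarrow> 'm tvec" where
  "spatial e t w = w $ 1 *\<^sub>R e 1 t + w $ 2 *\<^sub>R e 2 t + w $ 3 *\<^sub>R e 3 t"


section \<open>Random spin vectors\<close>

text \<open>The standard area measure of the unit sphere: the area of \<open>S\<close> is three times the volume of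
  the cone over \<open>S\<close> in the unit ball.\<close>

definition sphere_area :: "(real^3) measure" where
  "sphere_area =
     scale_measure 3
       (distr (restrict_space lborel (ball 0 1 - {0})) (restrict_space borel (sphere 0 1))
          (\<lambda>x. x /\<^sub>R norm x))"

lemma emeasure_sphere_area: "emeasure sphere_area (sphere 0 1) = ennreal (4 * pi)"
proof -
  have vol: "emeasure lborel (ball (0::real^3) 1) = ennreal (4 / 3 * pi)"
    using unit_ball_vol_odd'[of 1] by (simp add: emeasure_ball pochhammer_rec)
  have m: "(\<lambda>x::real^3. x /\<^sub>R norm x)
      \<in> restrict_space lborel (ball 0 1 - {0}) \<rightarrow>\<^sub>M restrict_space borel (sphere 0 1)"
    by (intro measurable_restrict_space3) auto
  have pre: "(\<lambda>x::real^3. x /\<^sub>R norm x) -` sphere 0 1 \<inter> (ball 0 1 - {0}) = ball 0 1 - {0}"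
    by auto
  have "emeasure sphere_area (sphere 0 1) =
      3 * emeasure (restrict_space lborel (ball 0 1 - {0::real^3})) (ball 0 1 - {0})"
    unfolding sphere_area_def
    by (subst emeasure_scale_measure, subst emeasure_distr[OF m])
       (auto simp: sets_restrict_space space_restrict_space pre)
  also have "\<dots> = 3 * emeasure lborel (ball (0::real^3) 1 - {0})"
    by (subst emeasure_restrict_space) auto
  also have "emeasure lborel (ball (0::real^3) 1 - {0}) = emeasure lborel (ball (0::real^3) 1)"
    by (intro emeasure_Diff_null_set) auto
  also have "3 * \<dots> = ennreal (4 * pi)"
    unfolding vol by (subst ennreal_numeral[symmetric], subst ennreal_mult[symmetric]) auto
  finally show ?thesis .
qed

text \<open>The distribution of the ontic spin vector leaving \<open>p = \<beta> 0\<close>, after a preparation with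
  outcome \<open>\<psi>\<close>.\<close>

definition ontic_spin_law ::
  "'m metric_field \<Rightarrow> ('m \<Rightarrow> 'm tvec \<Rightarrow> 'm tvec) \<Rightarrow> (real \<Rightarrow> 'm) \<Rightarrow> (4 \<Rightarrow> real \<Rightarrow> 'm tvec) \<Rightarrow>
    real^3 \<Rightarrow> (real^3) measure" where
  "ontic_spin_law g h \<beta> e \<psi> =
     density sphere_area
       (\<lambda>s. ennreal (indicator {s. h_hat g h (\<beta> 0) (spatial e 0 s) = spatial e 0 \<psi>} s *
                      (1 / pi * (\<psi> \<bullet> s))))"


section \<open>Kets\<close>

definition polar_vec :: "real \<Rightarrow> real \<Rightarrow> real^3" where
  "polar_vec \<theta> \<phi> = vector [sin \<theta> * cos \<phi>, sin \<theta> * sin \<phi>, cos \<theta>]"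

text \<open>Components with respect to the orthonormal basis of up and down.\<close>

definition polar_ket :: "real \<Rightarrow> real \<Rightarrow> complex^2" where
  "polar_ket \<theta> \<phi> = vector [of_real (cos (\<theta> / 2)), exp (\<i> * of_real \<phi>) * of_real (sin (\<theta> / 2))]"

text \<open>The azimuth is arbitrary at the poles. At the north pole it does not matter; at the south
  pole the ket is only determined up to a phase, and an arbitrary one is chosen.\<close>

definition ket :: "real^3 \<Rightarrow> complex^2" where
  "ket w = (SOME k. \<exists>\<theta> \<phi>. 0 \<le> \<theta> \<and> \<theta> \<le> pi \<and> 0 \<le> \<phi> \<and> \<phi> < 2 * pi \<and>
                          w = polar_vec \<theta> \<phi> \<and> k = polar_ket \<theta> \<phi>)"

definition braket :: "complex^2 \<Rightarrow> complex^2 \<Rightarrow> complex" where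
  "braket u w = (\<Sum>i\<in>UNIV. cnj (u $ i) * w $ i)"

end

theory Submission
  imports Defs "HOL-Probability.Distributions"
begin

text \<open>A parallel field has constant components with respect to a parallel frame, so \<open>s\<close> keeps its
  components on the way from \<open>p\<close> to \<open>q\<close>. As the internal metric is the \<open>g\<close>-orthogonal projection
  onto the line of \<open>n\<close>, the outcome is \<open>n\<close> precisely on the open hemisphere around \<open>n\<close>. The
  probability is therefore \<open>1 / \<pi>\<close> times the integral of \<open>\<psi> \<bullet> s\<close> over the lune where \<open>\<psi> \<bullet> s\<close> and
  \<open>\<phi> \<bullet> s\<close> are positive. On the hemisphere around \<open>\<phi>\<close>, the positive part of \<open>\<psi> \<bullet> s\<close> is half the sum
  of \<open>\<bar>\<psi> \<bullet> s\<bar>\<close>, whose integral is \<open>\<pi>\<close> by central symmetry, and of \<open>\<psi> \<bullet> s\<close>, whose integral is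
  \<open>\<pi> (\<psi> \<bullet> \<phi>)\<close> by symmetry under the half turn about \<open>\<phi>\<close>. So the probability is
  \<open>(1 + \<psi> \<bullet> \<phi>) / 2\<close>, which is also the squared overlap of the kets.\<close>

section \<open>Overlap of kets\<close>

text \<open>The polar angle is the arccosine of the third component. The azimuth is the argument, in
  [0, 2 pi), of the complex number \<open>z\<close> formed from the other two, whose modulus is sin
  \<theta>. At the poles \<open>z\<close> is 0 and any azimuth serves.\<close>

lemma ex_polar_coordinates:
  fixes w :: "real^3"
  assumes "norm w = 1"
  shows "\<exists>\<theta> \<phi>. 0 \<le> \<theta> \<and> \<theta> \<le> pi \<and> 0 \<le> \<phi> \<and> \<phi> < 2 * pi \<and> w = polar_vec \<theta> \<phi>"
proof -
  define \<theta> where "\<theta> = arccos (w $ 3)"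
  define z where "z = Complex (w $ 1) (w $ 2)"
  have sq: "(w $ 1)\<^sup>2 + (w $ 2)\<^sup>2 + (w $ 3)\<^sup>2 = 1"
    using assms by (simp add: norm_eq_1 inner_vec_def sum_3 power2_eq_square)
  have bd: "\<bar>w $ 3\<bar> \<le> 1"
    using component_le_norm_cart[of w 3] assms by simp
  have c: "cos \<theta> = w $ 3" and \<theta>: "0 \<le> \<theta>" "\<theta> \<le> pi"
    using bd by (auto simp: \<theta>_def abs_le_iff intro: arccos_lbound arccos_ubound)
  have "norm z = sin \<theta>"
    using bd sq by (simp add: z_def \<theta>_def sin_arccos cmod_def abs_le_iff algebra_simps)
  then have "w $ 1 = sin \<theta> * cos (Arg2pi z)" "w $ 2 = sin \<theta> * sin (Arg2pi z)"
    using Arg2pi_eq[of z] by (auto simp: z_def complex_eq_iff Re_exp Im_exp exp_eq_polar)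
  with c have "w = polar_vec \<theta> (Arg2pi z)"
    by (simp add: polar_vec_def vec_eq_iff forall_3)
  with \<theta> Arg2pi[of z] show ?thesis by blast
qed

text \<open>Only the difference \<open>d\<close> of the azimuths enters. In the half-angle variables
  both sides are polynomials, equal modulo the Pythagorean relations \<open>ab\<close>.\<close>

lemma cmod_braket_polar_ket:
  "(cmod (braket (polar_ket \<theta> \<phi>) (polar_ket \<theta>' \<phi>')))\<^sup>2 = (1 + polar_vec \<theta> \<phi> \<bullet> polar_vec \<theta>' \<phi>') / 2"
proof -
  define a b a' b' where "a = cos (\<theta>/2)" and "b = sin (\<theta>/2)" and "a' = cos (\<theta>'/2)" and "b' = sin (\<theta>'/2)"
  define d where "d = \<phi>' - \<phi>"
  have ab: "a\<^sup>2 + b\<^sup>2 = 1" "a'\<^sup>2 + b'\<^sup>2 = 1" "(sin d)\<^sup>2 + (cos d)\<^sup>2 = 1"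
    by (simp_all add: a_def b_def a'_def b'_def)
  have tr: "cos \<theta> = a\<^sup>2 - b\<^sup>2" "sin \<theta> = 2 * a * b" "cos \<theta>' = a'\<^sup>2 - b'\<^sup>2" "sin \<theta>' = 2 * a' * b'"
    using cos_double[of "\<theta>/2"] sin_double[of "\<theta>/2"] cos_double[of "\<theta>'/2"] sin_double[of "\<theta>'/2"]
    by (simp_all add: a_def b_def a'_def b'_def)
  have "braket (polar_ket \<theta> \<phi>) (polar_ket \<theta>' \<phi>') =
      of_real (a * a') + exp (\<i> * of_real d) * of_real (b * b')"
    by (simp add: braket_def polar_ket_def sum_2 exp_cnj d_def a_def b_def a'_def b'_def
        right_diff_distrib exp_diff exp_minus field_simps)
  also have "\<dots> = Complex (a * a' + cos d * (b * b')) (sin d * (b * b'))"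
    by (simp add: complex_eq_iff Re_exp Im_exp)
  finally have "(cmod (braket (polar_ket \<theta> \<phi>) (polar_ket \<theta>' \<phi>')))\<^sup>2 =
      (a * a' + cos d * (b * b'))\<^sup>2 + (sin d * (b * b'))\<^sup>2"
    by (simp add: cmod_power2)
  \<comment> \<open>The constant 1 on the right is the product of the two sums of squares, which
    cancels the mixed squares.\<close>
  also have "\<dots> = (1 + ((a\<^sup>2 - b\<^sup>2) * (a'\<^sup>2 - b'\<^sup>2) + (2 * a * b) * (2 * a' * b') * cos d)) / 2"
    using ab by algebra
  also have "(a\<^sup>2 - b\<^sup>2) * (a'\<^sup>2 - b'\<^sup>2) + (2 * a * b) * (2 * a' * b') * cos d =
      polar_vec \<theta> \<phi> \<bullet> polar_vec \<theta>' \<phi>'"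
    by (simp add: polar_vec_def inner_vec_def sum_3 d_def cos_diff flip: tr) (simp add: algebra_simps)
  finally show ?thesis .
qed

text \<open>Whatever \<open>ket\<close> chooses comes from some polar coordinates of the vector, and
  the polar formula holds for all of them. The arbitrary phase at the south pole thus drops
  out.\<close>

lemma cmod_braket_ket:
  assumes "norm v = 1" "norm w = 1"
  shows "(cmod (braket (ket v) (ket w)))\<^sup>2 = (1 + v \<bullet> w) / 2"
proof -
  have "\<exists>\<theta> \<phi>. 0 \<le> \<theta> \<and> \<theta> \<le> pi \<and> 0 \<le> \<phi> \<and> \<phi> < 2 * pi \<and> u = polar_vec \<theta> \<phi> \<and> ket u = polar_ket \<theta> \<phi>"
    if "norm u = 1" for u
    unfolding ket_def by (rule someI_ex) (use ex_polar_coordinates[OF that] in blast)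
  from this[OF assms(1)] this[OF assms(2)] show ?thesis
    using cmod_braket_polar_ket by metis
qed

section \<open>Integration on the sphere\<close>

lemma borel_measurable_orthogonal_transformation:
  fixes T :: "'a::euclidean_space \<Rightarrow> 'a"
  assumes "orthogonal_transformation T"
  shows "T \<in> borel_measurable borel"
  using orthogonal_transformation_linear[OF assms]
  by (intro borel_measurable_continuous_onI linear_continuous_on linear_conv_bounded_linear[THEN iffD1])

text \<open>Boxes determine \<open>lborel\<close>. The preimage of a box is its image under the
  orthogonal map \<open>inv T\<close>, and orthogonal images keep their Lebesgue measure.\<close>

lemma distr_lborel_orthogonal_transformation:
  fixes T :: "real^3 \<Rightarrow> real^3"
  assumes "orthogonal_transformation T"
  shows "distr lborel borel T = lborel"
proof (rule lborel_eqI[symmetric])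
  fix l u :: "real^3"
  assume le: "\<And>b. b \<in> Basis \<Longrightarrow> l \<bullet> b \<le> u \<bullet> b"
  note [measurable] = borel_measurable_orthogonal_transformation[OF assms]
  have bij: "bij T"
    by (rule orthogonal_transformation_bij[OF assms])
  have inv: "orthogonal_transformation (inv T)"
    by (rule orthogonal_transformation_inv[OF assms])
  have vim: "T -` box l u = inv T ` box l u"
    using bij by (simp add: bij_vimage_eq_inv_image)
  have lm: "inv T ` box l u \<in> lmeasurable" and
    m: "measure lebesgue (inv T ` box l u) = measure lebesgue (box l u)"
    using measurable_orthogonal_image[OF inv] measure_orthogonal_image[OF inv] by simp_all
  have "T -` box l u \<in> sets borel"
    using measurable_sets[of T borel borel "box l u"] by simp
  then have "emeasure lborel (T -` box l u) = emeasure lebesgue (inv T ` box l u)"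
    by (simp add: vim)
  also have "\<dots> = ennreal (measure lebesgue (box l u))"
    unfolding m[symmetric] by (rule emeasure_eq_measure2) (rule lm)
  finally show "emeasure (distr lborel borel T) (box l u) = ennreal (prod ((\<bullet>) (u - l)) Basis)"
    using le by (simp add: emeasure_distr measure_completion)
qed simp

lemma space_sphere_area: "space sphere_area = sphere 0 1"
  and sets_sphere_area [measurable_cong]: "sets sphere_area = sets (restrict_space borel (sphere 0 1))"
  by (simp_all add: sphere_area_def space_restrict_space space_scale_measure)

lemma finite_measure_sphere_area: "finite_measure sphere_area"
  by (rule finite_measureI) (simp add: space_sphere_area emeasure_sphere_area)

text \<open>The cone definition turns area integrals into volume integrals over the unit ball. The
  origin, excluded there because it has no direction, is a null set.\<close>

lemma nn_integral_sphere_area: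
  assumes [measurable]: "F \<in> borel_measurable borel"
  shows "(\<integral>\<^sup>+s. F s \<partial>sphere_area) = 3 * (\<integral>\<^sup>+x. F (x /\<^sub>R norm x) * indicator (ball 0 1) x \<partial>lborel)"
proof -
  have m: "(\<lambda>x::real^3. x /\<^sub>R norm x)
      \<in> restrict_space lborel (ball 0 1 - {0}) \<rightarrow>\<^sub>M restrict_space borel (sphere 0 1)"
    by (intro measurable_restrict_space3) auto
  have F: "F \<in> borel_measurable (restrict_space borel (sphere 0 1))"
    by (intro measurable_restrict_space1) simp
  have "(\<integral>\<^sup>+s. F s \<partial>sphere_area) =
      3 * (\<integral>\<^sup>+x. F (x /\<^sub>R norm x) * indicator (ball 0 1 - {0}) x \<partial>lborel)"
    unfolding sphere_area_def
    by (subst nn_integral_scale_measure)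
       (use F in \<open>simp_all add: nn_integral_distr[OF m] nn_integral_restrict_space\<close>)
  also have "(\<integral>\<^sup>+x. F (x /\<^sub>R norm x) * indicator (ball 0 1 - {0}) x \<partial>lborel) =
      (\<integral>\<^sup>+x. F (x /\<^sub>R norm x) * indicator (ball 0 1) x \<partial>lborel)"
    by (intro nn_integral_cong_AE) (use AE_lborel_singleton[of "0::real^3"] in
        \<open>auto elim!: eventually_mono split: split_indicator\<close>)
  finally show ?thesis .
qed

text \<open>An orthogonal map commutes with normalisation and preserves the unit ball, so the
  invariance of volume passes to the sphere.\<close>

lemma distr_sphere_area_orthogonal_transformation:
  assumes T: "orthogonal_transformation T"
  shows "distr sphere_area sphere_area T = sphere_area"
proof (rule measure_eqI)
  have lin: "linear T"
    using T orthogonal_transformation_linear by auto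
  note [measurable] = borel_measurable_orthogonal_transformation[OF T]
  have T_norm: "norm (T x) = norm x" for x
    using T by (simp add: orthogonal_transformation_norm)
  have Ts: "T \<in> sphere_area \<rightarrow>\<^sub>M sphere_area"
    unfolding measurable_cong_sets[OF sets_sphere_area sets_sphere_area]
    by (intro measurable_restrict_space3) (auto simp: T_norm)
  fix S assume "S \<in> sets (distr sphere_area sphere_area T)"
  then have S: "S \<in> sets sphere_area" by simp
  then obtain B where "B \<in> sets borel" "S = B \<inter> sphere 0 1"
    by (auto simp: sets_sphere_area sets_restrict_space)
  then have [measurable]: "S \<in> sets borel" by simp
  have [measurable]: "ball 0 1 \<in> sets (borel :: (real^3) measure)"
    by simp
  have "emeasure (distr sphere_area sphere_area T) S = (\<integral>\<^sup>+s. indicator S (T s) \<partial>sphere_area)"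
    using S Ts by (simp add: nn_integral_distr flip: nn_integral_indicator)
  also have "\<dots> = 3 * (\<integral>\<^sup>+x. indicator S (T (x /\<^sub>R norm x)) * indicator (ball 0 1) x \<partial>lborel)"
    by (subst nn_integral_sphere_area) simp_all
  also have "(\<integral>\<^sup>+x. indicator S (T (x /\<^sub>R norm x)) * indicator (ball 0 1) x \<partial>lborel) =
      (\<integral>\<^sup>+x. indicator S (T x /\<^sub>R norm (T x)) * indicator (ball 0 1) (T x) \<partial>lborel)"
    by (intro nn_integral_cong) (simp add: T_norm linear_cmul[OF lin] indicator_def)
  also have "\<dots> = (\<integral>\<^sup>+x. indicator S (x /\<^sub>R norm x) * indicator (ball 0 1) x \<partial>distr lborel borel T)"
    by (rule nn_integral_distr[symmetric]) measurable
  also have "3 * \<dots> = (\<integral>\<^sup>+s. indicator S s \<partial>sphere_area)"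
    unfolding distr_lborel_orthogonal_transformation[OF T] by (subst nn_integral_sphere_area) simp_all
  finally show "emeasure (distr sphere_area sphere_area T) S = emeasure sphere_area S"
    using S by simp
qed simp

text \<open>Serves three symmetry arguments: moving an axis to a given unit vector, the central
  symmetry, and the half turn.\<close>

lemma integral_sphere_area_orthogonal_transformation:
  fixes F :: "real^3 \<Rightarrow> real"
  assumes T: "orthogonal_transformation T" and F: "F \<in> borel_measurable borel"
  shows "(\<integral>s. F (T s) \<partial>sphere_area) = (\<integral>s. F s \<partial>sphere_area)"
proof -
  note [measurable] = borel_measurable_orthogonal_transformation[OF T]
  have Ts: "T \<in> sphere_area \<rightarrow>\<^sub>M sphere_area"
    unfolding measurable_cong_sets[OF sets_sphere_area sets_sphere_area]
    by (intro measurable_restrict_space3) (auto simp: orthogonal_transformation_norm[OF T])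
  have "F \<in> borel_measurable sphere_area"
    unfolding measurable_cong_sets[OF sets_sphere_area refl]
    by (intro measurable_restrict_space1 F)
  then show ?thesis
    using integral_distr[OF Ts, of F] by (simp add: distr_sphere_area_orthogonal_transformation[OF T])
qed

section \<open>Polar coordinates and the integral of the absolute inner product\<close>

lemma nn_integral_ball_homogeneous:
  fixes G :: "real^3 \<Rightarrow> ennreal"
  assumes [measurable]: "G \<in> borel_measurable borel" and "\<And>c x. 0 < c \<Longrightarrow> G (c *\<^sub>R x) = G x" and r: "0 < r"
  shows "(\<integral>\<^sup>+x. G x * indicator (ball 0 r) x \<partial>lborel) =
      ennreal (r ^ 3) * (\<integral>\<^sup>+x. G x * indicator (ball 0 1) x \<partial>lborel)"
proof -
  have [measurable]: "ball 0 r \<in> sets (borel :: (real^3) measure)"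
    by simp
  \<comment> \<open>Lebesgue measure is written as \<open>r ^ 3\<close> times its image under
    dilation by \<open>r\<close>, which leaves \<open>G\<close> unchanged.\<close>
  have "(\<integral>\<^sup>+x. G x * indicator (ball 0 r) x \<partial>lborel) =
     (\<integral>\<^sup>+x. G x * indicator (ball 0 r) x \<partial>density (distr lborel borel (\<lambda>x. 0 + r *\<^sub>R x)) (\<lambda>_. \<bar>r\<bar>^DIM(real^3)))"
    using lborel_affine[of r "0::real^3"] r by simp
  also have "\<dots> = ennreal (r ^ 3) * (\<integral>\<^sup>+x. G (r *\<^sub>R x) * indicator (ball 0 r) (r *\<^sub>R x) \<partial>lborel)"
    using r by (simp add: nn_integral_density nn_integral_distr nn_integral_cmult)
  also have "(\<integral>\<^sup>+x. G (r *\<^sub>R x) * indicator (ball 0 r) (r *\<^sub>R x) \<partial>lborel) =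
      (\<integral>\<^sup>+x. G x * indicator (ball 0 1) x \<partial>lborel)"
    using r assms by (intro nn_integral_cong) (simp add: indicator_def mult_less_cancel_left_pos)
  finally show ?thesis .
qed

text \<open>The half-line Gaussian moments of orders 0 and 1 are sqrt pi / 2 and 1 / 2; evenness
  doubles them.\<close>

lemma gauss_integrals:
  shows "(\<integral>\<^sup>+x. ennreal (exp (- x\<^sup>2)) \<partial>lborel) = ennreal (sqrt pi)"
    and "(\<integral>\<^sup>+x. ennreal (\<bar>x\<bar> * exp (- x\<^sup>2)) \<partial>lborel) = 1"
proof -
  have *: "(\<integral>\<^sup>+x. ennreal (\<bar>x\<bar> ^ k * exp (- x\<^sup>2)) \<partial>lborel) = ennreal (2 * v)"
    if "has_bochner_integral lborel (\<lambda>x::real. indicator {0..} x *\<^sub>R (exp (- x\<^sup>2) * x ^ k)) v" for k v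
  proof -
    have "has_bochner_integral lborel (\<lambda>x::real. indicator {0..} x *\<^sub>R (exp (- x\<^sup>2) * \<bar>x\<bar> ^ k)) v"
      by (rule has_bochner_integral_cong[THEN iffD1, OF _ _ _ that]) (auto simp: indicator_def)
    then have "has_bochner_integral lborel (\<lambda>x::real. exp (- x\<^sup>2) * \<bar>x\<bar> ^ k) (2 *\<^sub>R v)"
      by (rule has_bochner_integral_even_function) simp
    then have "has_bochner_integral lborel (\<lambda>x::real. \<bar>x\<bar> ^ k * exp (- x\<^sup>2)) (2 * v)"
      by (simp add: mult.commute)
    then show ?thesis
      by (subst nn_integral_eq_integral) (auto simp: has_bochner_integral_iff)
  qed
  show "(\<integral>\<^sup>+x. ennreal (exp (- x\<^sup>2)) \<partial>lborel) = ennreal (sqrt pi)"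
    using *[of 0 "sqrt pi / 2"] gaussian_moment_0 by simp
  show "(\<integral>\<^sup>+x. ennreal (\<bar>x\<bar> * exp (- x\<^sup>2)) \<partial>lborel) = 1"
    using *[OF gaussian_moment_odd_pos[of 0]] by simp
qed

text \<open>Both sides integrate \<rho> against a measure on the line: \<open>M\<close>, the radial
  image of \<open>G\<close> times volume, and \<open>N\<close>, with density \<open>A\<close> times
  r^2. For negative \<open>a\<close> both give the half-line \<open>{a<..}\<close> the mass A (-a)^3
  / 3, \<open>M\<close> by homogeneity and \<open>N\<close> by integrating r^2. Finiteness of
  \<open>A\<close> then yields \<open>M = N\<close>.\<close>

lemma nn_integral_polar_coordinates:
  fixes \<rho> :: "real \<Rightarrow> ennreal" and F :: "real^3 \<Rightarrow> ennreal"
  assumes [measurable]: "\<rho> \<in> borel_measurable borel" "F \<in> borel_measurable borel"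
    and fin: "(\<integral>\<^sup>+s. F s \<partial>sphere_area) < \<infinity>"
  shows "(\<integral>\<^sup>+x. F (x /\<^sub>R norm x) * \<rho> (norm x) \<partial>lborel) =
      (\<integral>\<^sup>+s. F s \<partial>sphere_area) * (\<integral>\<^sup>+r. ennreal (r\<^sup>2) * indicator {0<..} r * \<rho> r \<partial>lborel)"
proof -
  define A where "A = (\<integral>\<^sup>+s. F s \<partial>sphere_area)"
  define G where "G x = F (x /\<^sub>R norm x)" for x
  have [measurable]: "G \<in> borel_measurable borel"
    unfolding G_def by measurable
  have G_hom: "G (c *\<^sub>R x) = G x" if "0 < c" for c x
    using that by (simp add: G_def field_simps)
  \<comment> \<open>The sign makes the half-lines \<open>{a<..}\<close> of finite measure, as \<open>measure_eqI_lessThan\<close> requires.\<close>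
  define M where "M = distr (density lborel G) borel (\<lambda>x. - norm x)"
  define N where "N = density lborel (\<lambda>r. A * ennreal (r\<^sup>2) * indicator {..<0::real} r)"
  have A: "A = 3 * (\<integral>\<^sup>+x. G x * indicator (ball 0 1) x \<partial>lborel)"
    unfolding A_def G_def by (subst nn_integral_sphere_area) simp_all
  have M: "emeasure M {a<..} = (if a < 0 then ennreal ((- a) ^ 3) * (\<integral>\<^sup>+x. G x * indicator (ball 0 1) x \<partial>lborel) else 0)" for a
  proof -
    have "emeasure M {a<..} = (\<integral>\<^sup>+x. G x * indicator {a<..} (- norm x) \<partial>lborel)"
      unfolding M_def
      by (subst emeasure_distr, measurable, subst emeasure_density, measurable)
        (simp add: indicator_def vimage_def)
    also have "\<dots> = (\<integral>\<^sup>+x. G x * indicator (ball 0 (- a)) x \<partial>lborel)"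
      by (intro nn_integral_cong) (auto simp: indicator_def)
    finally show ?thesis
      using nn_integral_ball_homogeneous[of G "- a"] G_hom by (auto simp: ball_empty)
  qed
  have N: "emeasure N {a<..} = (if a < 0 then A * ennreal ((- a) ^ 3 / 3) else 0)" for a
  proof -
    have "emeasure N {a<..} = (\<integral>\<^sup>+r. A * (ennreal (r\<^sup>2) * indicator {a<..<0} r) \<partial>lborel)"
      unfolding N_def
      by (subst emeasure_density, measurable) (auto intro!: nn_integral_cong simp: indicator_def)
    also have "\<dots> = A * (\<integral>\<^sup>+r. ennreal (r\<^sup>2) * indicator {a<..<0} r \<partial>lborel)"
      by (rule nn_integral_cmult) measurable
    \<comment> \<open>Adding the two endpoints changes nothing almost everywhere and allows the
      fundamental theorem on a closed interval.\<close>
    also have "(\<integral>\<^sup>+r. ennreal (r\<^sup>2) * indicator {a<..<0} r \<partial>lborel) =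
        (\<integral>\<^sup>+r. ennreal (r\<^sup>2) * indicator {a..0} r \<partial>lborel)"
    proof (rule nn_integral_cong_AE)
      show "AE r in lborel. ennreal (r\<^sup>2) * indicator {a<..<0} r = ennreal (r\<^sup>2) * indicator {a..0} r"
        using AE_lborel_singleton[of a] AE_lborel_singleton[of "0::real"]
        by eventually_elim (auto simp: indicator_def)
    qed
    also have "\<dots> = (if a < 0 then ennreal ((- a) ^ 3 / 3) else 0)"
    proof (cases "a < 0")
      case True
      then show ?thesis
        by (subst nn_integral_FTC_Icc[where F="\<lambda>r. r ^ 3 / 3"])
          (auto intro!: derivative_eq_intros simp flip: has_real_derivative_iff_has_vector_derivative)
    next
      case False
      then have "(\<integral>\<^sup>+r. ennreal (r\<^sup>2) * indicator {a..0} r \<partial>lborel) = (\<integral>\<^sup>+r. 0 \<partial>(lborel :: real measure))"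
        by (intro nn_integral_cong) (auto simp: indicator_def)
      with False show ?thesis by simp
    qed
    finally show ?thesis by simp
  qed
  have MN: "emeasure M {a<..} = emeasure N {a<..}" for a
  proof (cases "a < 0")
    case True
    \<comment> \<open>The factor 3 in the cone definition of area meets the 1/3 from integrating
      r^2.\<close>
    then have "ennreal ((- a) ^ 3) = 3 * ennreal ((- a) ^ 3 / 3)"
      by (subst ennreal_numeral[symmetric], subst ennreal_mult[symmetric]) auto
    with True show ?thesis
      unfolding M N A by (simp add: ac_simps)
  qed (simp add: M N)
  have "M = N"
  proof (rule measure_eqI_lessThan)
    show "emeasure M {x<..} < \<infinity>" for x
      unfolding MN N using fin by (auto simp: A_def intro: ennreal_mult_less_top[THEN iffD2])
  qed (simp_all add: M_def N_def MN[unfolded M_def N_def])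
  have "(\<integral>\<^sup>+x. F (x /\<^sub>R norm x) * \<rho> (norm x) \<partial>lborel) = (\<integral>\<^sup>+r. \<rho> (- r) \<partial>M)"
    unfolding M_def
    by (subst nn_integral_distr, measurable, subst nn_integral_density, measurable) (simp add: G_def)
  also have "\<dots> = (\<integral>\<^sup>+r. A * (ennreal (r\<^sup>2) * indicator {..<0} r * \<rho> (- r)) \<partial>lborel)"
    unfolding \<open>M = N\<close> N_def
    by (subst nn_integral_density, measurable) (simp add: ac_simps)
  also have "\<dots> = A * (\<integral>\<^sup>+r. ennreal (r\<^sup>2) * indicator {..<0} r * \<rho> (- r) \<partial>lborel)"
    by (rule nn_integral_cmult) measurable
  \<comment> \<open>Reflecting the line undoes the sign built into \<open>M\<close> and
    \<open>N\<close>.\<close>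
  also have "(\<integral>\<^sup>+r. ennreal (r\<^sup>2) * indicator {..<0} r * \<rho> (- r) \<partial>lborel) =
      (\<integral>\<^sup>+r. ennreal (r\<^sup>2) * indicator {0<..} r * \<rho> r \<partial>lborel)"
    by (subst nn_integral_real_affine[where c="-1" and t=0], measurable)
      (auto intro!: nn_integral_cong simp: indicator_def)
  finally show ?thesis
    unfolding A_def .
qed


lemma integrable_sphere_area_bounded:
  fixes F :: "real^3 \<Rightarrow> real"
  assumes "F \<in> borel_measurable borel" and "\<And>s. norm s = 1 \<Longrightarrow> \<bar>F s\<bar> \<le> B"
  shows "integrable sphere_area F"
proof (rule finite_measure.integrable_const_bound[OF finite_measure_sphere_area, where B=B])
  show "F \<in> borel_measurable sphere_area"
    unfolding measurable_cong_sets[OF sets_sphere_area refl]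
    by (intro measurable_restrict_space1 assms(1))
  show "AE s in sphere_area. norm (F s) \<le> B"
    using assms(2) by (intro AE_I2) (simp add: space_sphere_area)
qed

lemma abs_inner_le_1:
  fixes v s :: "'a::real_inner"
  assumes "norm v = 1" "norm s = 1"
  shows "\<bar>v \<bullet> s\<bar> \<le> 1"
  using Cauchy_Schwarz_ineq2[of v s] assms by simp

text \<open>The value is read off the integral of \<open>\<bar>x\<^sub>1\<bar> exp (- \<bar>x\<bar>\<^sup>2)\<close> over the whole space, computed
  once in Cartesian and once in polar coordinates.\<close>

lemma integral_sphere_area_abs_axis:
  "(\<integral>s. \<bar>axis 1 1 \<bullet> s\<bar> \<partial>sphere_area) = 2 * pi"
proof -
  define b where "b = (axis 1 1 :: real^3)"
  have b: "b \<in> Basis" "norm b = 1"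
    by (auto simp: b_def)
  have int: "integrable sphere_area (\<lambda>s. \<bar>b \<bullet> s\<bar>)"
    by (rule integrable_sphere_area_bounded[where B=1]) (use abs_inner_le_1[OF b(2)] in auto)
  define I where "I = (\<integral>s. \<bar>b \<bullet> s\<bar> \<partial>sphere_area)"
  have I: "(\<integral>\<^sup>+s. ennreal \<bar>b \<bullet> s\<bar> \<partial>sphere_area) = ennreal I"
    unfolding I_def by (rule nn_integral_eq_integral[OF int]) simp
  have "0 \<le> I"
    unfolding I_def by simp
  \<comment> \<open>The radial factor: r^2 from polar coordinates and r from the length of
    \<open>x\<close> make it the third Gaussian moment on the half-line.\<close>
  have half: "(\<integral>\<^sup>+r. ennreal (r\<^sup>2) * indicator {0<..} r * ennreal (r * exp (- r\<^sup>2)) \<partial>lborel) = ennreal (1 / 2)"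
  proof -
    have "has_bochner_integral lborel (\<lambda>x::real. indicator {0..} x *\<^sub>R (exp (- x\<^sup>2) * x ^ 3)) (1 / 2)"
      using gaussian_moment_odd_pos[of 1] by (simp add: eval_nat_numeral)
    then have *: "integrable lborel (\<lambda>x::real. indicator {0..} x *\<^sub>R (exp (- x\<^sup>2) * x ^ 3))"
      "(\<integral>x. indicator {0..} x *\<^sub>R (exp (- x\<^sup>2) * x ^ 3) \<partial>(lborel :: real measure)) = 1 / 2"
      unfolding has_bochner_integral_iff by auto
    have "(\<integral>\<^sup>+x. ennreal (indicator {0..} x *\<^sub>R (exp (- x\<^sup>2) * x ^ 3)) \<partial>lborel) = ennreal (1 / 2)"
      unfolding *(2)[symmetric] by (rule nn_integral_eq_integral[OF *(1)]) (auto simp: indicator_def)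
    also have "(\<integral>\<^sup>+x. ennreal (indicator {0..} x *\<^sub>R (exp (- x\<^sup>2) * x ^ 3)) \<partial>lborel) =
      (\<integral>\<^sup>+r. ennreal (r\<^sup>2) * indicator {0<..} r * ennreal (r * exp (- r\<^sup>2)) \<partial>lborel)"
      by (intro nn_integral_cong) (auto simp: indicator_def eval_nat_numeral ac_simps simp flip: ennreal_mult)
    finally show ?thesis by simp
  qed
  \<comment> \<open>The integrand splits into one factor per coordinate, all Gaussian, with the
    extra absolute value only in the direction \<open>b\<close>.\<close>
  define f where "f c x = (if c = b then \<bar>x\<bar> else 1) * exp (- x\<^sup>2)" for c :: "real^3" and x :: real
  have f: "(\<Prod>c\<in>Basis. f c (x \<bullet> c)) = \<bar>b \<bullet> x\<bar> * exp (- (norm x)\<^sup>2)" for x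
  proof -
    have "(norm x)\<^sup>2 = (\<Sum>c\<in>Basis. (x \<bullet> c)\<^sup>2)"
      unfolding power2_norm_eq_inner by (subst euclidean_inner) (simp add: power2_eq_square)
    then show ?thesis
      using b by (simp add: f_def prod.distrib exp_sum flip: sum_negf) (simp add: prod.delta inner_commute)
  qed
  \<comment> \<open>The Cartesian value: the direction \<open>b\<close> contributes 1, each of the
    other two sqrt pi.\<close>
  have "ennreal pi = (\<Prod>c\<in>(Basis :: (real^3) set). if c = b then 1 else ennreal (sqrt pi))"
  proof -
    have "(\<Prod>c\<in>Basis - {b}. if c = b then 1 else ennreal (sqrt pi)) = (\<Prod>c\<in>Basis - {b}. ennreal (sqrt pi))"
      by (intro prod.cong) auto
    also have "\<dots> = ennreal pi"
      using b by (simp add: power2_eq_square flip: ennreal_mult)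
    finally show ?thesis
      using b by (subst prod.remove[of _ b]) simp_all
  qed
  also have "\<dots> = (\<Prod>c\<in>Basis. (\<integral>\<^sup>+x. f c x \<partial>lborel))"
    by (intro prod.cong) (auto simp: f_def gauss_integrals)
  also have "\<dots> = (\<integral>\<^sup>+x. (\<Prod>c\<in>Basis. ennreal (f c (x \<bullet> c))) \<partial>lborel)"
    by (rule nn_integral_lborel_prod[symmetric]) (auto simp: f_def)
  also have "\<dots> = (\<integral>\<^sup>+x. ennreal (\<bar>b \<bullet> x\<bar> * exp (- (norm x)\<^sup>2)) \<partial>lborel)"
    by (subst prod_ennreal) (auto simp: f_def simp flip: f)
  also have "\<dots> = (\<integral>\<^sup>+x. ennreal \<bar>b \<bullet> (x /\<^sub>R norm x)\<bar> * ennreal (norm x * exp (- (norm x)\<^sup>2)) \<partial>lborel)"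
  proof (rule nn_integral_cong)
    fix x :: "real^3"
    have "\<bar>b \<bullet> x\<bar> = \<bar>b \<bullet> (x /\<^sub>R norm x)\<bar> * norm x"
      by (cases "x = 0") (simp_all add: abs_mult)
    then show "ennreal (\<bar>b \<bullet> x\<bar> * exp (- (norm x)\<^sup>2)) = ennreal \<bar>b \<bullet> (x /\<^sub>R norm x)\<bar> * ennreal (norm x * exp (- (norm x)\<^sup>2))"
      by (simp add: mult.assoc flip: ennreal_mult)
  qed
  \<comment> \<open>The polar value. Comparison with the Cartesian one gives pi = I / 2.\<close>
  also have "\<dots> = ennreal I * ennreal (1 / 2)"
    using nn_integral_polar_coordinates[of "\<lambda>r. ennreal (r * exp (- r\<^sup>2))" "\<lambda>s. ennreal \<bar>b \<bullet> s\<bar>"]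
    by (simp add: I half)
  also have "\<dots> = ennreal (I / 2)"
    using \<open>0 \<le> I\<close> by (subst ennreal_mult[symmetric]) simp_all
  finally show ?thesis
    using \<open>0 \<le> I\<close> by (simp add: I_def b_def)
qed

text \<open>An orthogonal map taking the first axis to \<open>v\<close> reduces this to the axis
  case.\<close>

lemma integral_sphere_area_abs_inner:
  assumes "norm v = 1"
  shows "(\<integral>s. \<bar>v \<bullet> s\<bar> \<partial>sphere_area) = 2 * pi"
proof -
  obtain T :: "real^3 \<Rightarrow> real^3" where T: "orthogonal_transformation T" "T (axis 1 1) = v"
    by (rule orthogonal_transformation_exists_1[OF norm_axis_1[of 1] assms])
  have "v \<bullet> T s = axis 1 1 \<bullet> s" for s
    using T unfolding orthogonal_transformation_def by metis
  then show ?thesis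
    using integral_sphere_area_orthogonal_transformation[OF T(1), of "\<lambda>s. \<bar>v \<bullet> s\<bar>"]
      integral_sphere_area_abs_axis by simp
qed

section \<open>Integrals over hemispheres and lunes\<close>

text \<open>The cone over the great circle lies in a hyperplane, which has volume zero. This
  discards the common boundary of opposite hemispheres.\<close>

lemma AE_sphere_area_inner_neq_0:
  assumes "w \<noteq> 0"
  shows "AE s in sphere_area. w \<bullet> s \<noteq> 0"
proof -
  have [measurable]: "ball 0 1 \<in> sets (borel :: (real^3) measure)"
    by simp
  have "{x. w \<bullet> x = 0} \<in> null_sets lborel"
    using negligible_hyperplane[of w 0] assms
    by (simp add: negligible_iff_null_sets null_sets_completion_iff closed_hyperplane borel_closed)
  then have AE: "AE x in lborel. w \<bullet> x \<noteq> 0"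
    using AE_not_in by force
  have "(\<integral>\<^sup>+s. indicator {s. w \<bullet> s = 0} s \<partial>sphere_area) = 3 * (\<integral>\<^sup>+x. indicator {s. w \<bullet> s = 0} (x /\<^sub>R norm x) * indicator (ball 0 1) x \<partial>lborel)"
    by (rule nn_integral_sphere_area) measurable
  also have "(\<integral>\<^sup>+x. indicator {s. w \<bullet> s = 0} (x /\<^sub>R norm x) * indicator (ball 0 1) x \<partial>lborel) = (\<integral>\<^sup>+x. 0 \<partial>(lborel :: (real^3) measure))"
    using AE by (intro nn_integral_cong_AE) (auto elim!: eventually_mono simp: indicator_def)
  finally have *: "(\<integral>\<^sup>+s. indicator {s. w \<bullet> s = 0} s \<partial>sphere_area) = 0"
    by simp
  have "(\<lambda>s. indicator {s. w \<bullet> s = 0} s :: ennreal) \<in> borel_measurable sphere_area"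
    unfolding measurable_cong_sets[OF sets_sphere_area refl]
    by (intro measurable_restrict_space1) measurable
  from nn_integral_0_iff_AE[OF this] * show ?thesis
    by (simp add: indicator_def)
qed

text \<open>The central symmetry exchanges the hemispheres around \<open>w\<close> and
  \<open>- w\<close> and keeps the integrand, so each carries half of 2 pi.\<close>

lemma integral_hemisphere_abs_inner:
  assumes v: "norm v = 1" and w: "norm w = 1"
  shows "(\<integral>s. indicator {s. 0 < w \<bullet> s} s * \<bar>v \<bullet> s\<bar> \<partial>sphere_area) = pi" (is "?I = pi")
proof -
  have int: "integrable sphere_area (\<lambda>s. indicator {s. 0 < u \<bullet> s} s * \<bar>v \<bullet> s\<bar>)" for u
    by (rule integrable_sphere_area_bounded[where B=1])
      (use abs_inner_le_1 v in \<open>auto simp: indicator_def\<close>)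
  have "?I = (\<integral>s. indicator {s. 0 < w \<bullet> s} (- s) * \<bar>v \<bullet> (- s)\<bar> \<partial>sphere_area)"
    by (rule integral_sphere_area_orthogonal_transformation[symmetric])
      (simp_all add: orthogonal_transformation_neg[of "\<lambda>x. x"])
  also have "\<dots> = (\<integral>s. indicator {s. 0 < (- w) \<bullet> s} s * \<bar>v \<bullet> s\<bar> \<partial>sphere_area)"
    by (simp add: indicator_def)
  finally have "2 * ?I = (\<integral>s. indicator {s. 0 < w \<bullet> s} s * \<bar>v \<bullet> s\<bar> + indicator {s. 0 < (- w) \<bullet> s} s * \<bar>v \<bullet> s\<bar> \<partial>sphere_area)"
    by (subst Bochner_Integration.integral_add[OF int int]) simp
  also have "\<dots> = (\<integral>s. \<bar>v \<bullet> s\<bar> \<partial>sphere_area)"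
  proof (rule integral_cong_AE)
    have "w \<noteq> 0"
      using w by auto
    then show "AE s in sphere_area. indicator {s. 0 < w \<bullet> s} s * \<bar>v \<bullet> s\<bar> + indicator {s. 0 < (- w) \<bullet> s} s * \<bar>v \<bullet> s\<bar> = \<bar>v \<bullet> s\<bar>"
      using AE_sphere_area_inner_neq_0[of w] by (auto elim!: eventually_mono simp: indicator_def)
  qed (unfold measurable_cong_sets[OF sets_sphere_area refl], (intro measurable_restrict_space1; measurable)+)
  finally show ?thesis
    by (simp add: integral_sphere_area_abs_inner[OF v])
qed

text \<open>The half turn about \<open>w\<close> preserves the hemisphere and reverses the component of \<open>v\<close>
  orthogonal to \<open>w\<close>.\<close>

lemma integral_hemisphere_inner:
  assumes v: "norm v = 1" and w: "norm w = 1"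
  shows "(\<integral>s. indicator {s. 0 < w \<bullet> s} s * (v \<bullet> s) \<partial>sphere_area) = pi * (v \<bullet> w)" (is "?J = _")
proof -
  have int: "integrable sphere_area (\<lambda>s. indicator {s. 0 < w \<bullet> s} s * (u \<bullet> s))" if "norm u = 1" for u
    by (rule integrable_sphere_area_bounded[where B=1])
      (use abs_inner_le_1 that in \<open>auto simp: indicator_def\<close>)
  define R where "R s = (2 * (w \<bullet> s)) *\<^sub>R w - s" for s
  have w1: "w \<bullet> w = 1"
    using w by (simp add: norm_eq_1)
  have wR: "w \<bullet> R s = w \<bullet> s" and vR: "v \<bullet> R s = 2 * (v \<bullet> w) * (w \<bullet> s) - v \<bullet> s" for s
    by (simp_all add: R_def inner_diff_right w1)
  have R: "orthogonal_transformation R"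
    unfolding orthogonal_transformation_def
    by (auto simp: R_def linear_iff inner_add_right inner_diff_left inner_diff_right w1 inner_commute
        algebra_simps)
  have "?J = (\<integral>s. indicator {s. 0 < w \<bullet> s} (R s) * (v \<bullet> R s) \<partial>sphere_area)"
    by (rule integral_sphere_area_orthogonal_transformation[OF R, symmetric]) measurable
  \<comment> \<open>By \<open>vR\<close> and \<open>wR\<close>, \<open>?J\<close> equals a multiple
    of the integral for \<open>v = w\<close>, minus itself. That remaining integral is pi, since
    \<open>w \<bullet> s\<close> is positive on the hemisphere.\<close>
  also have "\<dots> = (\<integral>s. 2 * (v \<bullet> w) * (indicator {s. 0 < w \<bullet> s} s * (w \<bullet> s)) - indicator {s. 0 < w \<bullet> s} s * (v \<bullet> s) \<partial>sphere_area)"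
    by (intro Bochner_Integration.integral_cong) (simp_all add: vR wR indicator_def)
  also have "\<dots> = 2 * (v \<bullet> w) * (\<integral>s. indicator {s. 0 < w \<bullet> s} s * (w \<bullet> s) \<partial>sphere_area) - ?J"
    using int[OF v] int[OF w] by simp
  also have "(\<integral>s. indicator {s. 0 < w \<bullet> s} s * (w \<bullet> s) \<partial>sphere_area) = (\<integral>s. indicator {s. 0 < w \<bullet> s} s * \<bar>w \<bullet> s\<bar> \<partial>sphere_area)"
    by (intro Bochner_Integration.integral_cong) (simp_all add: indicator_def)
  also have "\<dots> = pi"
    by (rule integral_hemisphere_abs_inner[OF w w])
  finally show ?thesis
    by simp
qed

lemma integral_lune:
  assumes v: "norm v = 1" and w: "norm w = 1"
  shows "(\<integral>s. indicator {s. 0 < v \<bullet> s \<and> 0 < w \<bullet> s} s * (v \<bullet> s) \<partial>sphere_area) = pi * (1 + v \<bullet> w) / 2"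
proof -
  let ?i = "\<lambda>s. indicator {s. 0 < w \<bullet> s} s :: real"
  have "integrable sphere_area (\<lambda>s. ?i s * \<bar>v \<bullet> s\<bar>)" "integrable sphere_area (\<lambda>s. ?i s * (v \<bullet> s))"
    by (rule integrable_sphere_area_bounded[where B=1];
        use abs_inner_le_1 v in \<open>auto simp: indicator_def\<close>)+
  then have "(\<integral>s. (?i s * \<bar>v \<bullet> s\<bar> + ?i s * (v \<bullet> s)) / 2 \<partial>sphere_area) = (pi + pi * (v \<bullet> w)) / 2"
    by (simp add: integral_hemisphere_abs_inner[OF v w] integral_hemisphere_inner[OF v w])
  also have "(\<integral>s. (?i s * \<bar>v \<bullet> s\<bar> + ?i s * (v \<bullet> s)) / 2 \<partial>sphere_area) =
      (\<integral>s. indicator {s. 0 < v \<bullet> s \<and> 0 < w \<bullet> s} s * (v \<bullet> s) \<partial>sphere_area)"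
    by (intro Bochner_Integration.integral_cong) (auto simp: indicator_def)
  finally show ?thesis
    by (simp add: algebra_simps)
qed

text \<open>The density confines \<open>s\<close> to the hemisphere around \<open>v\<close> and the
  event to the one around \<open>w\<close>; together they cut out the lune.\<close>

lemma measure_lune:
  assumes v: "norm v = 1" and w: "norm w = 1"
  shows "measure (density sphere_area (\<lambda>s. ennreal (indicator {s. 0 < v \<bullet> s} s * (1 / pi * (v \<bullet> s)))))
           {s \<in> sphere 0 1. 0 < w \<bullet> s} = (1 + v \<bullet> w) / 2"
proof -
  let ?d = "\<lambda>s. indicator {s. 0 < v \<bullet> s} s * (1 / pi * (v \<bullet> s))"
  let ?L = "\<lambda>s. 1 / pi * (indicator {s. 0 < v \<bullet> s \<and> 0 < w \<bullet> s} s * (v \<bullet> s))"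
  have meas: "?d \<in> borel_measurable sphere_area"
    unfolding measurable_cong_sets[OF sets_sphere_area refl]
    by (intro measurable_restrict_space1) measurable
  have sets: "{s \<in> sphere 0 1. 0 < w \<bullet> s} \<in> sets sphere_area"
  proof -
    have "{s. 0 < w \<bullet> s} \<in> sets borel"
      by measurable
    then show ?thesis
      unfolding sets_sphere_area by (auto simp: sets_restrict_space)
  qed
  have int: "integrable sphere_area ?L"
    by (rule integrable_sphere_area_bounded[where B="1 / pi"])
      (use abs_inner_le_1[OF v] in \<open>auto simp: indicator_def abs_le_iff divide_simps\<close>)
  have "emeasure (density sphere_area (\<lambda>s. ennreal (?d s))) {s \<in> sphere 0 1. 0 < w \<bullet> s} =
      (\<integral>\<^sup>+s. ennreal (?d s) * indicator {s \<in> sphere 0 1. 0 < w \<bullet> s} s \<partial>sphere_area)"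
    using meas sets by (simp add: emeasure_density)
  also have "\<dots> = (\<integral>\<^sup>+s. ennreal (?L s) \<partial>sphere_area)"
    by (intro nn_integral_cong) (auto simp: indicator_def space_sphere_area)
  also have "\<dots> = ennreal (\<integral>s. ?L s \<partial>sphere_area)"
    by (rule nn_integral_eq_integral[OF int]) (auto simp: indicator_def)
  also have "(\<integral>s. ?L s \<partial>sphere_area) = (1 + v \<bullet> w) / 2"
    by (subst integral_mult_right_zero) (simp add: integral_lune[OF v w])
  \<comment> \<open>By Cauchy-Schwarz the value is nonnegative, so passing from
    \<open>ennreal\<close> back to the reals preserves it.\<close>
  finally show ?thesis
    using abs_inner_le_1[OF v w] by (simp add: measure_def abs_le_iff)
qed

section \<open>Orthonormal frames and parallel transport\<close>

lemma sum_fun_apply: "(\<Sum>i\<in>I. f i) x = (\<Sum>i\<in>I. f i x)"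
  by (induction I rule: infinite_finite_induct) simp_all

text \<open>Every other chart around \<open>x\<close> sees the image of \<open>w c\<close> under a
  linear differential, and charts elsewhere give 0 by convention. Hence vanishing can be tested in a
  single chart.\<close>

lemma tangent_space_eq_0:
  assumes "smooth_atlas A" "w \<in> tangent_space A x" "c \<in> charts_at A x" "w c = 0"
  shows "w = 0"
proof
  fix c'
  show "w c' = 0 c'"
  proof (cases "c' \<in> charts_at A x")
    case True
    \<comment> \<open>Order one gives differentiability, which makes
      \<open>frechet_derivative\<close> a linear map.\<close>
    have "Ck_on (Suc 0) (transition c c') (snd c ` (fst c \<inter> fst c'))"
      using assms(1,3) True unfolding smooth_atlas_def smooth_on_def charts_at_def by blast
    moreover have "snd c x \<in> snd c ` (fst c \<inter> fst c')"
      using assms(3) True by (auto simp: charts_at_def)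
    ultimately have "transition c c' differentiable at (snd c x)"
      unfolding Ck_on.simps by blast
    then have "linear (dtransition c c' x)"
      unfolding dtransition_def by (rule linear_frechet_derivative)
    moreover have "w c' = dtransition c c' x (w c)"
      using assms(2,3) True unfolding tangent_space_def by blast
    ultimately show ?thesis
      using assms(4) by (simp add: linear_0)
  next
    case False
    with assms(2) have "w c' = 0"
      unfolding tangent_space_def by blast
    then show ?thesis by simp
  qed
qed

lemma linear_frame_combination: "linear (\<lambda>a::real^'n. \<Sum>i\<in>UNIV. a $ i *\<^sub>R b i)"
  by (auto simp: linear_iff scaleR_left_distrib sum.distrib scaleR_sum_right)

text \<open>Linearity of \<open>f\<close> is known only on the tangent space, so the induction has
  to keep the partial sums inside it.\<close>

lemma linear_on_tangent_sum:
  fixes a :: "real^'n" and f :: "'m tvec \<Rightarrow> 'b::real_vector"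
  assumes f: "linear_on_tangent A x f" and sub: "subspace (tangent_space A x)"
    and b: "\<And>i. b i \<in> tangent_space A x"
  shows "f (\<Sum>i\<in>UNIV. a $ i *\<^sub>R b i) = (\<Sum>i\<in>UNIV. a $ i *\<^sub>R f (b i))"
proof -
  have add: "f (u + w) = f u + f w" if "u \<in> tangent_space A x" "w \<in> tangent_space A x" for u w
    using f that unfolding linear_on_tangent_def by blast
  have scale: "f (r *\<^sub>R w) = r *\<^sub>R f w" if "w \<in> tangent_space A x" for r w
    using f that unfolding linear_on_tangent_def by blast
  have zero: "f 0 = 0"
    using scale[of 0 0] subspace_0[OF sub] by simp
  have "f (\<Sum>i\<in>I. a $ i *\<^sub>R b i) = (\<Sum>i\<in>I. a $ i *\<^sub>R f (b i))" for I
  proof (induction I rule: infinite_finite_induct)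
    case (insert i I)
    have "a $ i *\<^sub>R b i \<in> tangent_space A x" "(\<Sum>i\<in>I. a $ i *\<^sub>R b i) \<in> tangent_space A x"
      by (auto intro!: subspace_scale subspace_sum sub b)
    from add[OF this] insert show ?case
      by (simp only: sum.insert scale[OF b] not_False_eq_True)
  qed (simp_all only: sum.infinite sum.empty zero not_False_eq_True)
  then show ?thesis .
qed

lemma orthonormal_frameD:
  assumes "orthonormal_frame A g x b"
  shows orthonormal_frame_subspace: "subspace (tangent_space A x)"
    and orthonormal_frame_mem: "b i \<in> tangent_space A x"
    and orthonormal_frame_metric: "g x (b i) (b j) = minkowski i j"
    and orthonormal_frame_ex: "w \<in> tangent_space A x \<Longrightarrow> \<exists>a::real^4. w = (\<Sum>i\<in>UNIV. a $ i *\<^sub>R b i)"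
proof -
  have span: "span (range b) = tangent_space A x"
    using assms by (simp add: orthonormal_frame_def)
  then show "subspace (tangent_space A x)"
    by (metis subspace_span)
  show "b i \<in> tangent_space A x"
    unfolding span[symmetric] by (simp add: span_base)
  show "g x (b i) (b j) = minkowski i j"
    using assms by (simp add: orthonormal_frame_def)
  \<comment> \<open>The combinations form a subspace that contains the frame, hence they exhaust its
    span.\<close>
  let ?f = "\<lambda>a::real^4. \<Sum>i\<in>UNIV. a $ i *\<^sub>R b i"
  have "b i = ?f (axis i 1)" for i
    by (simp add: axis_def if_distrib[of "\<lambda>r. r *\<^sub>R _"] cong: if_cong)
  then have "range b \<subseteq> range ?f"
    by blast
  then have "tangent_space A x \<subseteq> range ?f"
    unfolding span[symmetric]
    by (intro span_minimal linear_subspace_image linear_frame_combination subspace_UNIV)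
  then show "\<exists>a::real^4. w = ?f a" if "w \<in> tangent_space A x"
    using that by blast
qed

lemma frame_metric_combination:
  fixes a :: "real^4"
  assumes M: "lorentzian_manifold A g" and b: "orthonormal_frame A g x b" and u: "u \<in> tangent_space A x"
  shows "g x u (\<Sum>i\<in>UNIV. a $ i *\<^sub>R b i) = (\<Sum>i\<in>UNIV. a $ i * g x u (b i))"
proof -
  have "linear_on_tangent A x (g x u)"
    using M u by (simp add: lorentzian_manifold_def)
  from linear_on_tangent_sum[OF this orthonormal_frame_subspace[OF b], where b=b, OF orthonormal_frame_mem[OF b]]
  show ?thesis by simp
qed

lemma minkowski_diagonal_neq_0: "minkowski i i \<noteq> 0"
  by (simp add: minkowski_def)

text \<open>Orthogonality kills all other terms. As the remaining sign is nonzero, the metric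
  recovers the components of a vector, so they are unique.\<close>

lemma frame_metric_coefficient:
  fixes a :: "real^4"
  assumes M: "lorentzian_manifold A g" and b: "orthonormal_frame A g x b"
  shows "g x (b j) (\<Sum>i\<in>UNIV. a $ i *\<^sub>R b i) = a $ j * minkowski j j"
proof -
  have "g x (b j) (\<Sum>i\<in>UNIV. a $ i *\<^sub>R b i) = (\<Sum>i\<in>UNIV. a $ i * g x (b j) (b i))"
    by (rule frame_metric_combination[OF M b orthonormal_frame_mem[OF b]])
  also have "\<dots> = (\<Sum>i\<in>UNIV. if i = j then a $ j * minkowski j j else 0)"
    by (intro sum.cong) (auto simp: orthonormal_frame_metric[OF b] minkowski_def)
  finally show ?thesis
    by simp
qed

lemma frame_combination_inject:
  fixes a a' :: "real^4"
  assumes "lorentzian_manifold A g" "orthonormal_frame A g x b"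
    and "(\<Sum>i\<in>UNIV. a $ i *\<^sub>R b i) = (\<Sum>i\<in>UNIV. a' $ i *\<^sub>R b i)"
  shows "a = a'"
proof (unfold vec_eq_iff, rule allI)
  fix j
  have "a $ j * minkowski j j = a' $ j * minkowski j j"
    unfolding frame_metric_coefficient[OF assms(1,2), symmetric] assms(3) ..
  then show "a $ j = a' $ j"
    using minkowski_diagonal_neq_0[of j] by simp
qed

section \<open>Parallel fields and parallel transport\<close>

lemma differentiable_prod:
  fixes f :: "'i \<Rightarrow> 'a::real_normed_vector \<Rightarrow> 'b::real_normed_field"
  assumes "\<And>i. i \<in> I \<Longrightarrow> f i differentiable (at x within S)"
  shows "(\<lambda>x. \<Prod>i\<in>I. f i x) differentiable (at x within S)"
proof -
  have "\<forall>i\<in>I. \<exists>f'. (f i has_derivative f') (at x within S)"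
    using assms by (simp add: differentiable_def)
  then obtain f' where "\<And>i. i \<in> I \<Longrightarrow> (f i has_derivative f' i) (at x within S)"
    by metis
  from has_derivative_prod[OF this] show ?thesis
    by (rule differentiableI)
qed

text \<open>A determinant is a polynomial in its entries. This is needed to differentiate the
  quotients in Cramer's rule.\<close>

lemma differentiable_det:
  fixes M :: "'a::real_normed_vector \<Rightarrow> real^'n^'n"
  assumes "\<And>i j. (\<lambda>x. M x $ i $ j) differentiable (at x within S)"
  shows "(\<lambda>x. det (M x)) differentiable (at x within S)"
  unfolding det_def
  by (intro differentiable_sum ballI differentiable_mult differentiable_const finite differentiable_prod assms)

text \<open>The right-hand side of the parallel transport equation in the chart \<open>c\<close>,
  isolated so that its linearity in \<open>w\<close> can be used.\<close>

definition transport_rate where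
  "transport_rate A g I \<beta> t c w =
     (\<chi> i. - (\<Sum>j\<in>UNIV. \<Sum>k\<in>UNIV. christoffel A g c (snd c (\<beta> t)) i j k *
                          velocity A I \<beta> t c $ j * (w::real^4) $ k))"

lemma linear_transport_rate: "linear (transport_rate A g I \<beta> t c)"
  by (auto simp: linear_iff transport_rate_def vec_eq_iff algebra_simps sum.distrib sum_distrib_left)

lemma parallel_along_alt:
  "parallel_along A g I \<beta> X \<longleftrightarrow>
     (\<forall>t\<in>I. X t \<in> tangent_space A (\<beta> t) \<and>
        (\<forall>c\<in>charts_at A (\<beta> t).
           ((\<lambda>\<tau>. X \<tau> c) has_vector_derivative transport_rate A g I \<beta> t c (X t c)) (at t within I)))"
  by (simp add: parallel_along_def transport_rate_def)

text \<open>The transport equation is linear, and constant coefficients contribute no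
  derivative.\<close>

lemma parallel_along_combination:
  fixes a :: "real^'n"
  assumes e: "\<And>i. parallel_along A g I \<beta> (e i)"
    and sub: "\<And>t. t \<in> I \<Longrightarrow> subspace (tangent_space A (\<beta> t))"
  shows "parallel_along A g I \<beta> (\<lambda>t. \<Sum>i\<in>UNIV. a $ i *\<^sub>R e i t)"
  unfolding parallel_along_alt
proof (intro ballI conjI)
  fix t assume t: "t \<in> I"
  show "(\<Sum>i\<in>UNIV. a $ i *\<^sub>R e i t) \<in> tangent_space A (\<beta> t)"
    using e t by (auto simp: parallel_along_alt intro!: subspace_sum subspace_scale sub)
  fix c assume c: "c \<in> charts_at A (\<beta> t)"
  have "((\<lambda>\<tau>. \<Sum>i\<in>UNIV. a $ i *\<^sub>R e i \<tau> c) has_vector_derivative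
      (\<Sum>i\<in>UNIV. a $ i *\<^sub>R transport_rate A g I \<beta> t c (e i t c))) (at t within I)"
    using e t c unfolding parallel_along_alt
    by (intro has_vector_derivative_sum bounded_linear.has_vector_derivative[OF bounded_linear_scaleR_right]) auto
  then show "((\<lambda>\<tau>. (\<Sum>i\<in>UNIV. a $ i *\<^sub>R e i \<tau>) c) has_vector_derivative
      transport_rate A g I \<beta> t c ((\<Sum>i\<in>UNIV. a $ i *\<^sub>R e i t) c)) (at t within I)"
    by (simp add: sum_fun_apply scaleR_fun_def linear_sum[OF linear_transport_rate]
        linear_scale[OF linear_transport_rate])
qed

text \<open>The components are differentiable by Cramer's rule, so no uniqueness theorem for ordinary
  differential equations is needed.\<close>

lemma parallel_along_coefficients_const:
  fixes X :: "real \<Rightarrow> ('m::{t2_space,second_countable_topology}) tvec"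
  assumes M: "lorentzian_manifold A g" and "a < b"
    and frame: "\<And>t. t \<in> {a..b} \<Longrightarrow> orthonormal_frame A g (\<beta> t) (\<lambda>i. e i t)"
    and e: "\<And>i. parallel_along A g {a..b} \<beta> (e i)" and X: "parallel_along A g {a..b} \<beta> X"
  shows "\<exists>y::real^4. \<forall>t\<in>{a..b}. X t = (\<Sum>i\<in>UNIV. y $ i *\<^sub>R e i t)"
proof -
  let ?I = "{a..b}"
  have "\<forall>t\<in>?I. \<exists>y::real^4. X t = (\<Sum>i\<in>UNIV. y $ i *\<^sub>R e i t)"
    using X by (intro ballI orthonormal_frame_ex[OF frame]) (auto simp: parallel_along_alt)
  from bchoice[OF this] obtain y :: "real \<Rightarrow> real^4"
    where y: "X t = (\<Sum>i\<in>UNIV. y t $ i *\<^sub>R e i t)" if "t \<in> ?I" for t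
    by blast
  have "((\<lambda>\<tau>. y \<tau> $ k) has_derivative (\<lambda>h. 0)) (at t within ?I)" if t: "t \<in> ?I" for t k
  proof -
    have atlas: "smooth_atlas A"
      using M by (simp add: lorentzian_manifold_def)
    then have "\<beta> t \<in> (\<Union>c\<in>A. fst c)"
      by (simp add: smooth_atlas_def)
    then obtain c where c: "c \<in> charts_at A (\<beta> t)"
      unfolding charts_at_def by blast
    \<comment> \<open>The columns are the coordinate vectors of the frame in the one chart
      \<open>c\<close>.\<close>
    define E where "E \<tau> = (\<chi> i k. e k \<tau> c $ i)" for \<tau>
    have E: "E \<tau> *v z = (\<Sum>k\<in>UNIV. z $ k *\<^sub>R e k \<tau>) c" for \<tau> z
      by (simp add: E_def matrix_vector_mult_def vec_eq_iff sum_fun_apply scaleR_fun_def mult.commute)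
    have E_ker: "z = 0" if "E t *v z = 0" for z
    proof -
      have "(\<Sum>k\<in>UNIV. z $ k *\<^sub>R e k t) \<in> tangent_space A (\<beta> t)"
        using frame[OF t]
        by (intro subspace_sum subspace_scale) (auto intro: orthonormal_frame_subspace orthonormal_frame_mem)
      then have "(\<Sum>k\<in>UNIV. z $ k *\<^sub>R e k t) = 0"
        by (rule tangent_space_eq_0[OF atlas _ c]) (rule that[unfolded E])
      then show ?thesis
        by (intro frame_combination_inject[OF M frame[OF t]]) simp
    qed
    then have det: "det (E t) \<noteq> 0"
      using invertible_det_nz invertible_left_inverse matrix_left_invertible_ker by metis
    have e': "((\<lambda>\<tau>. e k \<tau> c) has_vector_derivative transport_rate A g ?I \<beta> t c (e k t c)) (at t within ?I)" for k
      using e t c by (simp add: parallel_along_alt)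
    have X': "((\<lambda>\<tau>. X \<tau> c) has_vector_derivative transport_rate A g ?I \<beta> t c (X t c)) (at t within ?I)"
      using X t c by (simp add: parallel_along_alt)
    have comp: "(\<lambda>\<tau>. f \<tau> $ i) differentiable (at t within ?I)"
      if "(f has_vector_derivative f') (at t within ?I)" for f :: "real \<Rightarrow> real^4" and f' i
      using bounded_linear.has_vector_derivative[OF bounded_linear_vec_nth that]
      by (auto intro: differentiableI_vector)
    have det': "(\<lambda>\<tau>. det (E \<tau>)) differentiable (at t within ?I)"
      by (rule differentiable_det) (simp add: E_def comp[OF e'])
    then have "\<forall>\<^sub>F \<tau> in at t within ?I. det (E \<tau>) \<noteq> 0"
      using det by (intro tendsto_imp_eventually_ne)
        \<comment> \<open>Nonvanishing is only local and rests on continuity: where the curve has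
          left the domain of \<open>c\<close>, all these columns are 0 by convention.\<close>
        (auto dest!: differentiable_imp_continuous_within simp: continuous_within)
    then obtain d where d: "d > 0" "\<And>\<tau>. \<tau> \<in> ?I \<Longrightarrow> dist \<tau> t < d \<Longrightarrow> det (E \<tau>) \<noteq> 0"
      using det unfolding eventually_at by metis
    have dy: "(\<lambda>\<tau>. y \<tau> $ k) differentiable (at t within ?I)" for k
    proof (rule differentiable_transform_within[OF _ \<open>d > 0\<close> t])
      \<comment> \<open>Cramer's numerator: column \<open>k\<close> is replaced by the coordinates
        of \<open>X\<close>.\<close>
      let ?N = "\<lambda>\<tau>. det (\<chi> i j. if j = k then X \<tau> c $ i else E \<tau> $ i $ j)"
      have "?N differentiable (at t within ?I)"
      proof (rule differentiable_det)
        show "(\<lambda>\<tau>. (\<chi> i j. if j = k then X \<tau> c $ i else E \<tau> $ i $ j) $ i $ j) differentiable (at t within ?I)" for i j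
          by (cases "j = k") (simp_all add: E_def comp[OF e'] comp[OF X'])
      qed
      then show "(\<lambda>\<tau>. ?N \<tau> / det (E \<tau>)) differentiable (at t within ?I)"
        using det' det by (rule differentiable_divide)
      show "?N \<tau> / det (E \<tau>) = y \<tau> $ k" if "\<tau> \<in> ?I" "dist \<tau> t < d" for \<tau>
      proof -
        have "E \<tau> *v y \<tau> = X \<tau> c"
          by (simp only: E y[OF that(1)])
        from cramer_lemma[of k "E \<tau>" "y \<tau>", unfolded this] show ?thesis
          using d(2)[OF that] by simp
      qed
    qed
    then have "\<forall>k. \<exists>y'. ((\<lambda>\<tau>. y \<tau> $ k) has_real_derivative y') (at t within ?I)"
      unfolding real_differentiable_def by blast
    from choice[OF this] obtain y' where y': "((\<lambda>\<tau>. y \<tau> $ k) has_real_derivative y' k) (at t within ?I)" for k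
      by blast
    \<comment> \<open>The product rule is compared with the transport equation for \<open>X\<close>.
      The transport terms cancel, so \<open>E t\<close> annihilates the derivatives of the
      components.\<close>
    have "((\<lambda>\<tau>. \<Sum>k\<in>UNIV. y \<tau> $ k *\<^sub>R e k \<tau> c) has_vector_derivative
        (\<Sum>k\<in>UNIV. y t $ k *\<^sub>R transport_rate A g ?I \<beta> t c (e k t c) + y' k *\<^sub>R e k t c)) (at t within ?I)"
      by (intro has_vector_derivative_sum has_vector_derivative_scaleR y' e')
    then have "((\<lambda>\<tau>. X \<tau> c) has_vector_derivative
        (\<Sum>k\<in>UNIV. y t $ k *\<^sub>R transport_rate A g ?I \<beta> t c (e k t c) + y' k *\<^sub>R e k t c)) (at t within ?I)"
      by (rule has_vector_derivative_transform[OF t, rotated])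
        (simp add: y sum_fun_apply scaleR_fun_def)
    with X' have "transport_rate A g ?I \<beta> t c (X t c) =
        (\<Sum>k\<in>UNIV. y t $ k *\<^sub>R transport_rate A g ?I \<beta> t c (e k t c) + y' k *\<^sub>R e k t c)"
      using t \<open>a < b\<close> by (intro vector_derivative_unique_within_closed_interval[of a b t "\<lambda>\<tau>. X \<tau> c"]) auto
    also have "transport_rate A g ?I \<beta> t c (X t c) =
        (\<Sum>k\<in>UNIV. y t $ k *\<^sub>R transport_rate A g ?I \<beta> t c (e k t c))"
      by (simp add: y[OF t] sum_fun_apply scaleR_fun_def linear_sum[OF linear_transport_rate]
          linear_scale[OF linear_transport_rate])
    finally have "E t *v (\<chi> k. y' k) = 0"
      by (simp add: E sum.distrib sum_fun_apply scaleR_fun_def)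
    then have "y' k = 0"
      using E_ker by (metis vec_lambda_beta zero_index)
    then show ?thesis
      using y'[of k] by (simp add: has_field_derivative_def lambda_zero)
  qed
  then have "\<forall>k. \<exists>z. \<forall>t\<in>?I. y t $ k = z"
    by (intro allI has_derivative_zero_constant) auto
  from choice[OF this] obtain z where z: "y t $ k = z k" if "t \<in> ?I" for t k
    by blast
  show ?thesis
    by (intro exI[of _ "\<chi> k. z k"]) (simp add: y z)
qed

text \<open>The description by \<open>THE\<close> calls for existence, from constant combinations of
  the frame, and uniqueness: a competitor has constant components, fixed by its value at
  \<open>a\<close>.\<close>

lemma parallel_transport_combination:
  fixes e :: "4 \<Rightarrow> real \<Rightarrow> ('m::{t2_space,second_countable_topology}) tvec" and z :: "real^4"
  assumes M: "lorentzian_manifold A g" and "a < b"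
    and frame: "\<And>t. t \<in> {a..b} \<Longrightarrow> orthonormal_frame A g (\<beta> t) (\<lambda>i. e i t)"
    and e: "\<And>i. parallel_along A g {a..b} \<beta> (e i)"
  shows "parallel_transport A g \<beta> a b (\<Sum>i\<in>UNIV. z $ i *\<^sub>R e i a) = (\<Sum>i\<in>UNIV. z $ i *\<^sub>R e i b)"
  unfolding parallel_transport_def
proof (rule the_equality)
  have "parallel_along A g {a..b} \<beta> (\<lambda>t. \<Sum>i\<in>UNIV. z $ i *\<^sub>R e i t)"
    by (rule parallel_along_combination[OF e orthonormal_frame_subspace[OF frame]])
  then show "\<exists>X. parallel_along A g {a..b} \<beta> X \<and> X a = (\<Sum>i\<in>UNIV. z $ i *\<^sub>R e i a) \<and> X b = (\<Sum>i\<in>UNIV. z $ i *\<^sub>R e i b)"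
    by blast
next
  fix w assume "\<exists>X. parallel_along A g {a..b} \<beta> X \<and> X a = (\<Sum>i\<in>UNIV. z $ i *\<^sub>R e i a) \<and> X b = w"
  then obtain X where X: "parallel_along A g {a..b} \<beta> X" "X a = (\<Sum>i\<in>UNIV. z $ i *\<^sub>R e i a)" "X b = w"
    by blast
  obtain y :: "real^4" where y: "\<forall>t\<in>{a..b}. X t = (\<Sum>i\<in>UNIV. y $ i *\<^sub>R e i t)"
    using parallel_along_coefficients_const[OF M \<open>a < b\<close> frame e X(1)] by blast
  have "y = z"
    using y X(2) \<open>a < b\<close> by (intro frame_combination_inject[OF M frame[of a]]) auto
  then show "w = (\<Sum>i\<in>UNIV. z $ i *\<^sub>R e i b)"
    using y X(3) \<open>a < b\<close> by auto
qed

section \<open>Projection to the internal space\<close>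

text \<open>Recasts \<open>spatial\<close> as a frame combination with time component 0. In the
  index type \<open>4\<close> the time index 0 coincides with the numeral 4.\<close>

definition spatial_coords :: "real^3 \<Rightarrow> real^4" where
  "spatial_coords w = (\<chi> i. if i = 1 then w $ 1 else if i = 2 then w $ 2 else if i = 3 then w $ 3 else 0)"

lemma spatial_eq: "spatial e t w = (\<Sum>i\<in>UNIV. spatial_coords w $ i *\<^sub>R e i t)"
  by (simp add: spatial_def spatial_coords_def sum_4)

lemma spatial_mem:
  assumes "orthonormal_frame A g (\<beta> t) (\<lambda>i. e i t)"
  shows "spatial e t w \<in> tangent_space A (\<beta> t)"
  unfolding spatial_eq
  by (intro subspace_sum subspace_scale orthonormal_frame_subspace[OF assms] orthonormal_frame_mem[OF assms])

lemma metric_spatial: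
  assumes M: "lorentzian_manifold A g" and b: "orthonormal_frame A g (\<beta> t) (\<lambda>i. e i t)"
  shows "g (\<beta> t) (spatial e t u) (spatial e t w) = - (u \<bullet> w)"
proof -
  have "g (\<beta> t) (spatial e t u) (e i t) = minkowski i i * spatial_coords u $ i" for i
  proof -
    have "g (\<beta> t) (spatial e t u) (e i t) = g (\<beta> t) (e i t) (spatial e t u)"
      using M spatial_mem[where e=e and t=t and \<beta>=\<beta>, OF b] orthonormal_frame_mem[OF b] unfolding lorentzian_manifold_def by blast
    then show ?thesis
      using frame_metric_coefficient[OF M b] by (simp add: spatial_eq)
  qed
  then have "g (\<beta> t) (spatial e t u) (spatial e t w) =
      (\<Sum>i\<in>UNIV. spatial_coords w $ i * (minkowski i i * spatial_coords u $ i))"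
    using frame_metric_combination[OF M b spatial_mem[where e=e and t=t and \<beta>=\<beta>, OF b]] by (simp add: spatial_eq[of _ _ w])
  also have "\<dots> = - (u \<bullet> w)"
    by (simp add: sum_4 spatial_coords_def minkowski_def inner_vec_def sum_3)
  finally show ?thesis .
qed

text \<open>The projection sends \<open>s\<close> to \<open>n\<close> times
  \<open>k = n \<bullet> s\<close>, and normalising leaves the sign of \<open>k\<close> times
  \<open>n\<close>.\<close>

lemma h_hat_spatial:
  assumes M: "lorentzian_manifold A g" and b: "orthonormal_frame A g (\<beta> t) (\<lambda>i. e i t)"
    and h: "internal_metric_at A g (\<beta> t) v (h (\<beta> t))"
    and n: "norm n = 1" "span {spatial e t n} = internal_space A h (\<beta> t)"
  shows "h_hat g h (\<beta> t) (spatial e t s) = spatial e t n \<longleftrightarrow> 0 < n \<bullet> s"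
proof -
  let ?x = "\<beta> t" and ?n = "spatial e t n" and ?s = "spatial e t s"
  have mem: "spatial e t w \<in> tangent_space A ?x" for w
    by (rule spatial_mem[where e=e and t=t and \<beta>=\<beta>, OF b])
  have lin: "linear_on_tangent A ?x (g ?x u)" if "u \<in> tangent_space A ?x" for u
    using M that by (simp add: lorentzian_manifold_def)
  have gnn: "g ?x ?n ?n = - 1"
    using metric_spatial[where e=e and t=t and \<beta>=\<beta>, OF M b] n by (simp add: norm_eq_1)
  obtain k where k: "h ?x ?s = k *\<^sub>R ?n"
  proof -
    have "h ?x ?s \<in> span {?n}"
      using mem n(2) by (auto simp: internal_space_def)
    then show ?thesis
      using that by (auto simp: span_singleton)
  qed
  have "?n \<in> internal_space A h ?x"
    unfolding n(2)[symmetric] by (simp add: span_base)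
  \<comment> \<open>An idempotent map fixes its image. With this, the symmetry of the projection
    moves it from \<open>?n\<close> to \<open>?s\<close> and yields \<open>k\<close>.\<close>
  then have "h ?x ?n = ?n"
    using h by (auto simp: internal_space_def internal_metric_at_def)
  then have "g ?x ?n ?s = g ?x ?n (k *\<^sub>R ?n)"
    using h mem k unfolding internal_metric_at_def by metis
  also have "\<dots> = - k"
    using lin[OF mem] mem gnn by (simp add: linear_on_tangent_def)
  finally have k_eq: "k = n \<bullet> s"
    using metric_spatial[where e=e and t=t and \<beta>=\<beta>, OF M b] by simp
  have "g ?x (k *\<^sub>R ?n) (k *\<^sub>R ?n) = - (k * k)"
  proof -
    have kn: "k *\<^sub>R ?n \<in> tangent_space A ?x"
      by (intro subspace_scale mem orthonormal_frame_subspace[OF b])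
    have "g ?x (k *\<^sub>R ?n) (k *\<^sub>R ?n) = k * g ?x (k *\<^sub>R ?n) ?n"
      using lin[OF kn] mem by (simp add: linear_on_tangent_def)
    also have "g ?x (k *\<^sub>R ?n) ?n = g ?x ?n (k *\<^sub>R ?n)"
      using M kn mem unfolding lorentzian_manifold_def by blast
    also have "\<dots> = - k"
      using lin[OF mem] mem gnn by (simp add: linear_on_tangent_def)
    finally show ?thesis by simp
  qed
  then have norm_k: "lorentz_norm g ?x (h ?x ?s) = \<bar>k\<bar>"
    by (simp add: lorentz_norm_def k)
  have "?n \<noteq> 0"
  proof
    assume "?n = 0"
    then have "g ?x ?n ?n = g ?x ?n (0 *\<^sub>R ?n)"
      by simp
    also have "\<dots> = 0"
      using lin[OF mem] mem by (simp add: linear_on_tangent_def del: scaleR_zero_left)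
    finally show False
      using gnn by simp
  qed
  \<comment> \<open>For \<open>k = 0\<close> the default value of \<open>h_hat\<close> agrees with
    \<open>sgn 0 = 0\<close>.\<close>
  moreover have "h_hat g h ?x ?s = sgn k *\<^sub>R ?n"
    unfolding h_hat_def norm_k by (simp add: k sgn_if)
  ultimately have "h_hat g h ?x ?s = ?n \<longleftrightarrow> sgn k = 1"
    using scaleR_cancel_right[of "sgn k" ?n 1] by simp
  then show ?thesis
    by (simp add: k_eq sgn_1_pos)
qed

section \<open>The Born rule along the worldline\<close>

theorem theorem4p3:
  fixes A :: "('m::{t2_space,second_countable_topology}) chart set"
    and g :: "'m metric_field"
    and \<beta> :: "real \<Rightarrow> 'm"
    and \<epsilon> :: real
    and e :: "4 \<Rightarrow> real \<Rightarrow> 'm tvec"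
    and h :: "'m \<Rightarrow> 'm tvec \<Rightarrow> 'm tvec"
    and \<psi> \<phi> :: "real^3"
  assumes "lorentzian_manifold A g" and "orientable A"
    and "\<epsilon> > 0"
    and "differentiable_curve A {0..\<epsilon>} \<beta>"
    and "\<forall>t\<in>{0..\<epsilon>}. g (\<beta> t) (velocity A {0..\<epsilon>} \<beta> t) (velocity A {0..\<epsilon>} \<beta> t) = 1"
    and "\<forall>t\<in>{0..\<epsilon>}. e 0 t = velocity A {0..\<epsilon>} \<beta> t"
    and "\<forall>t\<in>{0..\<epsilon>}. orthonormal_frame A g (\<beta> t) (\<lambda>i. e i t)"
    and "\<forall>i. parallel_along A g {0..\<epsilon>} \<beta> (e i)"
    and "\<forall>t\<in>{0..\<epsilon>}. internal_metric_at A g (\<beta> t) (velocity A {0..\<epsilon>} \<beta> t) (h (\<beta> t))"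
    and "dim (internal_space A h (\<beta> 0)) = 1"
    and "dim (internal_space A h (\<beta> \<epsilon>)) = 1"
    and "\<forall>t\<in>{0<..<\<epsilon>}. dim (internal_space A h (\<beta> t)) > 1"
    and "\<psi> \<in> sphere 0 1" and "span {spatial e 0 \<psi>} = internal_space A h (\<beta> 0)"
    and "\<phi> \<in> sphere 0 1" and "span {spatial e \<epsilon> \<phi>} = internal_space A h (\<beta> \<epsilon>)"
  shows "measure (ontic_spin_law g h \<beta> e \<psi>)
           {s \<in> sphere 0 1.
              h_hat g h (\<beta> \<epsilon>) (parallel_transport A g \<beta> 0 \<epsilon> (spatial e 0 s)) = spatial e \<epsilon> \<phi>}
         = (cmod (braket (ket \<phi>) (ket \<psi>)))\<^sup>2"
proof -
  note M = assms(1) and frame = assms(7)[rule_format] and par = assms(8)[rule_format] and h = assms(9)[rule_format]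
  have \<psi>: "norm \<psi> = 1" and \<phi>: "norm \<phi> = 1"
    using assms(13,15) by simp_all
  \<comment> \<open>At \<open>p\<close> the preparation condition is the open hemisphere around
    \<psi>, which gives the law the density of \<open>measure_lune\<close>.\<close>
  have "h_hat g h (\<beta> 0) (spatial e 0 s) = spatial e 0 \<psi> \<longleftrightarrow> 0 < \<psi> \<bullet> s" for s
    using \<open>\<epsilon> > 0\<close> by (intro h_hat_spatial[where e=e and \<beta>=\<beta> and t=0, OF M frame h \<psi> assms(14)]) auto
  then have law: "ontic_spin_law g h \<beta> e \<psi> =
      density sphere_area (\<lambda>s. ennreal (indicator {s. 0 < \<psi> \<bullet> s} s * (1 / pi * (\<psi> \<bullet> s))))"
    unfolding ontic_spin_law_def by simp
  \<comment> \<open>The spin vector keeps its components in the tetrad, so the outcome at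
    \<open>q\<close> is decided by the same point of the sphere.\<close>
  have "parallel_transport A g \<beta> 0 \<epsilon> (spatial e 0 s) = spatial e \<epsilon> s" for s
    unfolding spatial_eq by (rule parallel_transport_combination[OF M \<open>\<epsilon> > 0\<close> frame par])
  moreover have "h_hat g h (\<beta> \<epsilon>) (spatial e \<epsilon> s) = spatial e \<epsilon> \<phi> \<longleftrightarrow> 0 < \<phi> \<bullet> s" for s
    using \<open>\<epsilon> > 0\<close> by (intro h_hat_spatial[where e=e and \<beta>=\<beta> and t=\<epsilon>, OF M frame h \<phi> assms(16)]) auto
  ultimately have "{s \<in> sphere 0 1.
      h_hat g h (\<beta> \<epsilon>) (parallel_transport A g \<beta> 0 \<epsilon> (spatial e 0 s)) = spatial e \<epsilon> \<phi>} =
      {s \<in> sphere 0 1. 0 < \<phi> \<bullet> s}"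
    by simp
  then show ?thesis
    unfolding law by (simp only: measure_lune[OF \<psi> \<phi>] cmod_braket_ket[OF \<phi> \<psi>] inner_commute[of \<phi> \<psi>])
qed

end
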